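(* Let $(W,S)$ be a Coxeter system of finite rank, let $\Delta=(\mathcal{C},\delta)$ be a thick locally finite building of type $(W,S)$, and equip $\mathrm{Aut}(\Delta)$ with the permutation topology. Let $G\le \mathrm{Aut}(\Delta)$ be closed and Weyl-transitive, let $\Sigma\subseteq\mathcal{C}$ be an apartment, let $c\in\Sigma$ and let $t\in \mathrm{Stab}_G(\Sigma)$ be such that $t|_\Sigma\in\mathrm{Aut}(\Sigma)$ is a translation. Then $G_c\cap \mathrm{Aut}_0(\Delta)$ is tidy for $t$.
   Context: Buildings. For a Coxeter system $(W,S)$ (with $S$ finite) let $\ell$ be the length function and $m_{st}$ the order of $st$. A building of type $(W,S)$ is a pair $\Delta=(\mathcal{C},\delta)$ with $\mathcal{C}\neq\emptyset$ (elements: chambers) and $\delta:\mathcal{C}\times\mathcal{C}\to W$ such that for $x,y\in\mathcal{C}$, $w=\delta(x,y)$: (1) $w=1$ iff $x=y$; (2) if $\delta(y,z)=s\in S$ then $\delta(x,z)\in\{w,ws\}$, and $\delta(x,z)=ws$ if $\ell(ws)=\ell(w)+1$; (3) for each $s\in S$ there is $z$ with $\delta(y,z)=s$ and $\delta(x,z)=ws$. Chambers $x,y$ are adjacent if $\delta(x,y)\in S$; galleries are sequences of consecutively adjacent chambers, and a gallery is minimal if it has minimal length among galleries with the same endpoints. For $J\subseteq S$ a $J$-residue is a set $\{y\mid\delta(x,y)\in\langle J\rangle\}$; panels are residues with $|J|=1$. $\Delta$ is thick if every panel has at least 3 chambers and locally finite if every panel is finite. For a bijection $\sigma:S\to S$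 with $m_{\sigma(s)\sigma(t)}=m_{st}$ for all $s,t$, a $\sigma$-isomorphism between sets of chambers is a bijection $\phi$ with $\delta(x,y)=s\iff\delta(\phi(x),\phi(y))=\sigma(s)$ for all $x,y$ and $s\in S$; an isomorphism is a $\sigma$-isomorphism for some such $\sigma$; it is special if $\sigma=\mathrm{id}$. $\mathrm{Aut}(\Delta)$ is the group of all automorphisms (isomorphisms from $\mathcal{C}$ to itself), $\mathrm{Aut}_0(\Delta)$ the subgroup of special ones. $G\le\mathrm{Aut}(\Delta)$ is Weyl-transitive if for every $w\in W$ the group $G\cap\mathrm{Aut}_0(\Delta)$ acts transitively on the ordered pairs $(c,d)$ of chambers with $\delta(c,d)=w$. $G_c$ is the stabilizer of the chamber $c$, and $\mathrm{Stab}_G(\Sigma)$ the setwise stabilizer of $\Sigma$. The permutation topology (from the action on $\mathcal{C}$) has the pointwise stabilizers of finite sets of chambers as a basis of identity neighbourhoods; it makes $\mathrm{Aut}(\Delta)$ a totally disconnected locally compact group. A subset of $\mathcal{C}$ is convex if it contains every minimal gallery between any two of its chambers. An apartment is a non-empty convex subset $\Sigma\subseteq\mathcal{C}$ such that $P\cap\Sigma$ has exactly two chambers for each panel $P$ meeting $\Sigma$. For $c\in\Sigma$, $x\mapsto\delta(c,x)$ is a special isomorphism from $\Sigma$ to the Coxeter building $\Sigma(W,S)=(W,(x,y)\mapsto x^{-1}y)$. Roots of $\Sigma(W,S)$ are the sets $v\alpha_s$ ($v\in W,s\in S$), $\alpha_s=\{w\in W\mid\ell(sw)>\ell(w)\}$;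 roots of $\Sigma$ correspond to these under the isomorphism. Two roots $\alpha,\beta$ are parallel if $\alpha\subseteq\beta$ or $\beta\subseteq\alpha$. A translation of $\Sigma$ is a (not necessarily special) automorphism of $\Sigma$ mapping each root to a parallel root. Tidiness. For a totally disconnected locally compact group $G$, $\alpha\in\mathrm{Aut}(G)$ and a compact open subgroup $U$, put $U_{\alpha\pm}=\bigcap_{n\ge0}\alpha^{\pm n}(U)$. $U$ is tidy for $\alpha$ if $U=U_{\alpha+}U_{\alpha-}$ and $\bigcup_{n\ge0}\alpha^{-n}(U_{\alpha-})$ is closed. $U$ is tidy for $g\in G$ if it is a compact open subgroup tidy for $x\mapsto gxg^{-1}$. *)

theory Defs
  imports "HOL-Analysis.Abstract_Topology" "HOL-Algebra.Multiplicative_Group" "HOL-Algebra.Generated_Groups"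
    "HOL-Algebra.Bij"
begin

section \<open>Coxeter systems\<close>

definition word_prod :: "('w, 'm) monoid_scheme \<Rightarrow> 'w list \<Rightarrow> 'w" where
  "word_prod W ws = foldr (\<otimes>\<^bsub>W\<^esub>) ws \<one>\<^bsub>W\<^esub>"

text \<open>The Coxeter number \<open>m\<^sub>s\<^sub>t\<close>; the value \<open>0\<close> of \<open>group.ord\<close> encodes \<open>m\<^sub>s\<^sub>t = \<infinity>\<close>.\<close>

definition cox_m :: "('w, 'm) monoid_scheme \<Rightarrow> 'w \<Rightarrow> 'w \<Rightarrow> nat" where
  "cox_m W s t = group.ord W (s \<otimes>\<^bsub>W\<^esub> t)"

text \<open>The congruence on the free monoid over \<open>S\<close> generated by \<open>(st)^m\<^sub>s\<^sub>t = 1\<close>. For \<open>s = t\<close> the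
  relation is \<open>ss = 1\<close>, so no formal inverses are needed and the quotient is the group
  with presentation \<open>\<langle>S | (st)^m\<^sub>s\<^sub>t\<rangle>\<close>. If \<open>m\<^sub>s\<^sub>t = \<infinity>\<close>, coded as \<open>0\<close>, the relation is vacuous.\<close>

inductive cox_cong :: "('w, 'm) monoid_scheme \<Rightarrow> 'w set \<Rightarrow> 'w list \<Rightarrow> 'w list \<Rightarrow> bool"
  for W S where
  rel: "\<lbrakk>s \<in> S; t \<in> S; us \<in> lists S; vs \<in> lists S\<rbrakk> \<Longrightarrow>
          cox_cong W S (us @ concat (replicate (cox_m W s t) [s, t]) @ vs) (us @ vs)"
| refl: "us \<in> lists S \<Longrightarrow> cox_cong W S us us"
| sym: "cox_cong W S us vs \<Longrightarrow> cox_cong W S vs us"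
| trans: "\<lbrakk>cox_cong W S us vs; cox_cong W S vs ws\<rbrakk> \<Longrightarrow> cox_cong W S us ws"

locale coxeter_system = group W for W (structure) and S +
  assumes gens_closed: "S \<subseteq> carrier W"
    and gens_involutions: "s \<in> S \<Longrightarrow> s \<noteq> \<one> \<and> s \<otimes> s = \<one>"
    and gens_generate: "generate W S = carrier W"
    and presentation: "\<lbrakk>us \<in> lists S; vs \<in> lists S; word_prod W us = word_prod W vs\<rbrakk>
                        \<Longrightarrow> cox_cong W S us vs"

definition cox_length :: "('w, 'm) monoid_scheme \<Rightarrow> 'w set \<Rightarrow> 'w \<Rightarrow> nat" where
  "cox_length W S w = (LEAST n. \<exists>ws \<in> lists S. length ws = n \<and> word_prod W ws = w)"

definition simple_root :: "('w, 'm) monoid_scheme \<Rightarrow> 'w set \<Rightarrow> 'w \<Rightarrow> 'w set" where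
  "simple_root W S s =
    {w \<in> carrier W. cox_length W S (s \<otimes>\<^bsub>W\<^esub> w) > cox_length W S w}"

definition coxeter_roots :: "('w, 'm) monoid_scheme \<Rightarrow> 'w set \<Rightarrow> 'w set set" where
  "coxeter_roots W S = {v <#\<^bsub>W\<^esub> simple_root W S s | v s. v \<in> carrier W \<and> s \<in> S}"


section \<open>Buildings\<close>

locale building = coxeter_system W S for W (structure) and S +
  fixes C :: "'c set" and \<delta> :: "'c \<Rightarrow> 'c \<Rightarrow> 'a"
  assumes chambers_nonempty: "C \<noteq> {}"
    and dist_closed: "\<lbrakk>x \<in> C; y \<in> C\<rbrakk> \<Longrightarrow> \<delta> x y \<in> carrier W"
    and dist_one: "\<lbrakk>x \<in> C; y \<in> C\<rbrakk> \<Longrightarrow> \<delta> x y = \<one> \<longleftrightarrow> x = y"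
    and dist_step: "\<lbrakk>x \<in> C; y \<in> C; z \<in> C; \<delta> y z \<in> S\<rbrakk> \<Longrightarrow>
          \<delta> x z \<in> {\<delta> x y, \<delta> x y \<otimes> \<delta> y z} \<and>
          (cox_length W S (\<delta> x y \<otimes> \<delta> y z) = cox_length W S (\<delta> x y) + 1 \<longrightarrow>
             \<delta> x z = \<delta> x y \<otimes> \<delta> y z)"
    and dist_extend: "\<lbrakk>x \<in> C; y \<in> C; s \<in> S\<rbrakk> \<Longrightarrow>
          \<exists>z \<in> C. \<delta> y z = s \<and> \<delta> x z = \<delta> x y \<otimes> s"

definition residue ::
    "('w, 'm) monoid_scheme \<Rightarrow> 'c set \<Rightarrow> ('c \<Rightarrow> 'c \<Rightarrow> 'w) \<Rightarrow> 'w set \<Rightarrow> 'c \<Rightarrow> 'c set" where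
  "residue W C \<delta> J x = {y \<in> C. \<delta> x y \<in> generate W J}"

definition panels ::
    "('w, 'm) monoid_scheme \<Rightarrow> 'w set \<Rightarrow> 'c set \<Rightarrow> ('c \<Rightarrow> 'c \<Rightarrow> 'w) \<Rightarrow> 'c set set" where
  "panels W S C \<delta> = {residue W C \<delta> {s} x | s x. s \<in> S \<and> x \<in> C}"

definition thick ::
    "('w, 'm) monoid_scheme \<Rightarrow> 'w set \<Rightarrow> 'c set \<Rightarrow> ('c \<Rightarrow> 'c \<Rightarrow> 'w) \<Rightarrow> bool" where
  "thick W S C \<delta> \<longleftrightarrow> (\<forall>P \<in> panels W S C \<delta>. infinite P \<or> card P \<ge> 3)"

definition locally_finite ::
    "('w, 'm) monoid_scheme \<Rightarrow> 'w set \<Rightarrow> 'c set \<Rightarrow> ('c \<Rightarrow> 'c \<Rightarrow> 'w) \<Rightarrow> bool" where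
  "locally_finite W S C \<delta> \<longleftrightarrow> (\<forall>P \<in> panels W S C \<delta>. finite P)"

definition gallery ::
    "'w set \<Rightarrow> 'c set \<Rightarrow> ('c \<Rightarrow> 'c \<Rightarrow> 'w) \<Rightarrow> 'c \<Rightarrow> 'c \<Rightarrow> 'c list \<Rightarrow> bool" where
  "gallery S C \<delta> x y xs \<longleftrightarrow>
     xs \<noteq> [] \<and> set xs \<subseteq> C \<and> hd xs = x \<and> last xs = y \<and> successively (\<lambda>a b. \<delta> a b \<in> S) xs"

definition minimal_gallery ::
    "'w set \<Rightarrow> 'c set \<Rightarrow> ('c \<Rightarrow> 'c \<Rightarrow> 'w) \<Rightarrow> 'c \<Rightarrow> 'c \<Rightarrow> 'c list \<Rightarrow> bool" where
  "minimal_gallery S C \<delta> x y xs \<longleftrightarrow>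
     gallery S C \<delta> x y xs \<and> (\<forall>ys. gallery S C \<delta> x y ys \<longrightarrow> length xs \<le> length ys)"

definition gallery_convex :: "'w set \<Rightarrow> 'c set \<Rightarrow> ('c \<Rightarrow> 'c \<Rightarrow> 'w) \<Rightarrow> 'c set \<Rightarrow> bool" where
  "gallery_convex S C \<delta> A \<longleftrightarrow> A \<subseteq> C \<and>
     (\<forall>x \<in> A. \<forall>y \<in> A. \<forall>xs. minimal_gallery S C \<delta> x y xs \<longrightarrow> set xs \<subseteq> A)"

definition apartment ::
    "('w, 'm) monoid_scheme \<Rightarrow> 'w set \<Rightarrow> 'c set \<Rightarrow> ('c \<Rightarrow> 'c \<Rightarrow> 'w) \<Rightarrow> 'c set \<Rightarrow> bool" where
  "apartment W S C \<delta> A \<longleftrightarrow> A \<noteq> {} \<and> gallery_convex S C \<delta> A \<and>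
     (\<forall>P \<in> panels W S C \<delta>. P \<inter> A \<noteq> {} \<longrightarrow> card (P \<inter> A) = 2)"


section \<open>Automorphisms\<close>

definition diagram_perm :: "('w, 'm) monoid_scheme \<Rightarrow> 'w set \<Rightarrow> ('w \<Rightarrow> 'w) \<Rightarrow> bool" where
  "diagram_perm W S \<sigma> \<longleftrightarrow>
     bij_betw \<sigma> S S \<and> (\<forall>s \<in> S. \<forall>t \<in> S. cox_m W (\<sigma> s) (\<sigma> t) = cox_m W s t)"

definition sigma_iso ::
    "'w set \<Rightarrow> ('c \<Rightarrow> 'c \<Rightarrow> 'w) \<Rightarrow> ('w \<Rightarrow> 'w) \<Rightarrow> 'c set \<Rightarrow> 'c set \<Rightarrow> ('c \<Rightarrow> 'c) \<Rightarrow> bool" where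
  "sigma_iso S \<delta> \<sigma> X Y f \<longleftrightarrow> bij_betw f X Y \<and>
     (\<forall>x \<in> X. \<forall>y \<in> X. \<forall>s \<in> S. \<delta> x y = s \<longleftrightarrow> \<delta> (f x) (f y) = \<sigma> s)"

text \<open>Both sets below are used for \<open>X\<close> the set of all chambers and for \<open>X\<close> an apartment.
  As in \<open>BijGroup\<close>, maps are extensional, i.e. \<open>undefined\<close> outside \<open>X\<close>.\<close>

definition auts ::
    "('w, 'm) monoid_scheme \<Rightarrow> 'w set \<Rightarrow> ('c \<Rightarrow> 'c \<Rightarrow> 'w) \<Rightarrow> 'c set \<Rightarrow> ('c \<Rightarrow> 'c) set" where
  "auts W S \<delta> X = {f \<in> Bij X. \<exists>\<sigma>. diagram_perm W S \<sigma> \<and> sigma_iso S \<delta> \<sigma> X X f}"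

definition special_auts :: "'w set \<Rightarrow> ('c \<Rightarrow> 'c \<Rightarrow> 'w) \<Rightarrow> 'c set \<Rightarrow> ('c \<Rightarrow> 'c) set" where
  "special_auts S \<delta> X = {f \<in> Bij X. sigma_iso S \<delta> id X X f}"

definition aut_group ::
    "('w, 'm) monoid_scheme \<Rightarrow> 'w set \<Rightarrow> 'c set \<Rightarrow> ('c \<Rightarrow> 'c \<Rightarrow> 'w) \<Rightarrow> ('c \<Rightarrow> 'c) monoid" where
  "aut_group W S C \<delta> = (BijGroup C)\<lparr>carrier := auts W S \<delta> C\<rparr>"

definition weyl_transitive ::
    "('w, 'm) monoid_scheme \<Rightarrow> 'w set \<Rightarrow> 'c set \<Rightarrow> ('c \<Rightarrow> 'c \<Rightarrow> 'w) \<Rightarrow> ('c \<Rightarrow> 'c) set \<Rightarrow> bool" where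
  "weyl_transitive W S C \<delta> G \<longleftrightarrow>
     (\<forall>w \<in> carrier W. \<forall>c \<in> C. \<forall>d \<in> C. \<forall>c' \<in> C. \<forall>d' \<in> C. \<delta> c d = w \<and> \<delta> c' d' = w \<longrightarrow>
        (\<exists>g \<in> G \<inter> special_auts S \<delta> C. g c = c' \<and> g d = d'))"

text \<open>Roots of an apartment \<open>A\<close> are the preimages of the roots of the Coxeter building under
  \<open>x \<mapsto> \<delta> c x\<close>. Changing \<open>c \<in> A\<close> changes this map by a left multiplication in \<open>W\<close>, which permutes
  the roots of the Coxeter building, so letting \<open>c\<close> range over \<open>A\<close> adds nothing.\<close>

definition apartment_roots ::
    "('w, 'm) monoid_scheme \<Rightarrow> 'w set \<Rightarrow> ('c \<Rightarrow> 'c \<Rightarrow> 'w) \<Rightarrow> 'c set \<Rightarrow> 'c set set" where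
  "apartment_roots W S \<delta> A =
     {{x \<in> A. \<delta> c x \<in> r} | c r. c \<in> A \<and> r \<in> coxeter_roots W S}"

definition parallel_roots :: "'c set \<Rightarrow> 'c set \<Rightarrow> bool" where
  "parallel_roots \<alpha> \<beta> \<longleftrightarrow> \<alpha> \<subseteq> \<beta> \<or> \<beta> \<subseteq> \<alpha>"

definition apartment_translation ::
    "('w, 'm) monoid_scheme \<Rightarrow> 'w set \<Rightarrow> ('c \<Rightarrow> 'c \<Rightarrow> 'w) \<Rightarrow> 'c set \<Rightarrow> ('c \<Rightarrow> 'c) \<Rightarrow> bool" where
  "apartment_translation W S \<delta> A \<tau> \<longleftrightarrow> \<tau> \<in> auts W S \<delta> A \<and>
     (\<forall>\<alpha> \<in> apartment_roots W S \<delta> A.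
        \<tau> ` \<alpha> \<in> apartment_roots W S \<delta> A \<and> parallel_roots \<alpha> (\<tau> ` \<alpha>))"


section \<open>The permutation topology\<close>

definition pointwise_stab :: "('c \<Rightarrow> 'c) set \<Rightarrow> 'c set \<Rightarrow> ('c \<Rightarrow> 'c) set" where
  "pointwise_stab G F = {g \<in> G. \<forall>x \<in> F. g x = x}"

definition perm_topology :: "('c \<Rightarrow> 'c) monoid \<Rightarrow> 'c set \<Rightarrow> ('c \<Rightarrow> 'c) topology" where
  "perm_topology G C = topology (\<lambda>U. U \<subseteq> carrier G \<and>
     (\<forall>g \<in> U. \<exists>F. finite F \<and> F \<subseteq> C \<and> g <#\<^bsub>G\<^esub> pointwise_stab (carrier G) F \<subseteq> U))"

lemma openin_perm_topology:
  "openin (perm_topology G C) U \<longleftrightarrow> U \<subseteq> carrier G \<and>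
     (\<forall>g \<in> U. \<exists>F. finite F \<and> F \<subseteq> C \<and> g <#\<^bsub>G\<^esub> pointwise_stab (carrier G) F \<subseteq> U)"
proof -
  define L where "L = (\<lambda>U. U \<subseteq> carrier G \<and>
     (\<forall>g \<in> U. \<exists>F. finite F \<and> F \<subseteq> C \<and> g <#\<^bsub>G\<^esub> pointwise_stab (carrier G) F \<subseteq> U))"
  have mono: "g <#\<^bsub>G\<^esub> pointwise_stab (carrier G) F' \<subseteq> g <#\<^bsub>G\<^esub> pointwise_stab (carrier G) F"
    if "F \<subseteq> F'" for g F F'
    using that by (auto simp: l_coset_def pointwise_stab_def)
  have "L (U \<inter> V)" if UV: "L U" "L V" for U V
    unfolding L_def
  proof (intro conjI ballI)
    show "U \<inter> V \<subseteq> carrier G"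
      using UV by (auto simp: L_def)
    fix g assume "g \<in> U \<inter> V"
    then obtain F1 F2 where F: "finite F1" "F1 \<subseteq> C" "finite F2" "F2 \<subseteq> C"
      "g <#\<^bsub>G\<^esub> pointwise_stab (carrier G) F1 \<subseteq> U" "g <#\<^bsub>G\<^esub> pointwise_stab (carrier G) F2 \<subseteq> V"
      using UV unfolding L_def by (metis (no_types, lifting) IntD1 IntD2)
    show "\<exists>F. finite F \<and> F \<subseteq> C \<and> g <#\<^bsub>G\<^esub> pointwise_stab (carrier G) F \<subseteq> U \<inter> V"
      using F mono[of F1 "F1 \<union> F2" g] mono[of F2 "F1 \<union> F2" g]
      by (intro exI[of _ "F1 \<union> F2"]) auto
  qed
  moreover have "L (\<Union>K)" if K: "\<forall>U \<in> K. L U" for K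
    unfolding L_def
  proof (intro conjI ballI)
    show "\<Union>K \<subseteq> carrier G"
      using K by (auto simp: L_def)
    fix g assume "g \<in> \<Union>K"
    then obtain U where "U \<in> K" "g \<in> U" by blast
    with K obtain F where "finite F" "F \<subseteq> C" "g <#\<^bsub>G\<^esub> pointwise_stab (carrier G) F \<subseteq> U"
      unfolding L_def by meson
    with \<open>U \<in> K\<close> show "\<exists>F. finite F \<and> F \<subseteq> C \<and> g <#\<^bsub>G\<^esub> pointwise_stab (carrier G) F \<subseteq> \<Union>K"
      by blast
  qed
  ultimately have "istopology L"
    unfolding istopology_def by blast
  then have "openin (perm_topology G C) = L"
    unfolding perm_topology_def L_def by (rule topology_inverse')
  then show ?thesis
    by (simp add: L_def)
qed


section \<open>Tidy subgroups\<close>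

text \<open>Here \<open>T\<close> is a topology on \<open>carrier G\<close> and \<open>\<alpha>\<close> an automorphism of the group \<open>G\<close>; negative
  powers of \<open>\<alpha>\<close> are powers of its inverse on \<open>carrier G\<close>.\<close>

definition tidy_plus :: "('g \<Rightarrow> 'g) \<Rightarrow> 'g set \<Rightarrow> 'g set" where
  "tidy_plus \<alpha> U = (\<Inter>n::nat. (\<alpha> ^^ n) ` U)"

definition tidy_minus :: "('g, 'm) monoid_scheme \<Rightarrow> ('g \<Rightarrow> 'g) \<Rightarrow> 'g set \<Rightarrow> 'g set" where
  "tidy_minus G \<alpha> U = (\<Inter>n::nat. (inv_into (carrier G) \<alpha> ^^ n) ` U)"

definition tidy_for_aut ::
    "('g, 'm) monoid_scheme \<Rightarrow> 'g topology \<Rightarrow> ('g \<Rightarrow> 'g) \<Rightarrow> 'g set \<Rightarrow> bool" where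
  "tidy_for_aut G T \<alpha> U \<longleftrightarrow>
     subgroup U G \<and> compactin T U \<and> openin T U \<and>
     U = tidy_plus \<alpha> U <#>\<^bsub>G\<^esub> tidy_minus G \<alpha> U \<and>
     closedin T (\<Union>n::nat. (inv_into (carrier G) \<alpha> ^^ n) ` tidy_minus G \<alpha> U)"

definition tidy_for ::
    "('g, 'm) monoid_scheme \<Rightarrow> 'g topology \<Rightarrow> 'g \<Rightarrow> 'g set \<Rightarrow> bool" where
  "tidy_for G T g U \<longleftrightarrow>
     tidy_for_aut G T (\<lambda>x \<in> carrier G. g \<otimes>\<^bsub>G\<^esub> x \<otimes>\<^bsub>G\<^esub> inv\<^bsub>G\<^esub> g) U"

end

theory Submission
  imports Defs "HOL-Analysis.Function_Topology"
begin

text \<open>The argument lives on the orbit of \<open>c\<close> under the powers of \<open>t\<close>, and its heart is that this orbit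
is a straight line: for \<open>i \<le> j \<le> k\<close>, the chamber \<open>t\<^sup>j c\<close> lies on a minimal gallery from \<open>t\<^sup>i c\<close> to
\<open>t\<^sup>k c\<close>. Inside an apartment a chamber lies on a minimal gallery between two others unless some root
contains both of them but not it (\<open>between_if_no_root_separates\<close>). If a root \<open>\<alpha>\<close> contained
\<open>t\<^sup>i c\<close> and \<open>t\<^sup>k c\<close> but not \<open>t\<^sup>j c\<close>, then the orbit would leave \<open>\<alpha>\<close> and come back; but \<open>t \<alpha>\<close> is
parallel to \<open>\<alpha>\<close>, so either \<open>t \<alpha> \<subseteq> \<alpha>\<close>, and the orbit never leaves \<open>\<alpha>\<close>, or \<open>\<alpha> \<subseteq> t \<alpha>\<close>, and it
never returns once it has left (\<open>translation_orbit_between\<close>).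

Straightness is useful because a special automorphism is rigid along minimal galleries: a chamber
on a minimal gallery is determined by the two ends and its distance from one of them, so special
automorphisms that agree at both ends agree in between (\<open>special_auts_agree_between\<close>).

Write \<open>U\<close> for the group of special elements of \<open>G\<close> that fix \<open>c\<close>. Conjugation by \<open>t\<close> moves fixed
chambers by \<open>t\<close>, so \<open>U\<^sub>+\<close> and \<open>U\<^sub>-\<close> are the groups fixing \<open>t\<^sup>n c\<close>, respectively
\<open>t\<^sup>-\<^sup>n c\<close>, for all \<open>n \<ge> 0\<close>. The subgroup \<open>U\<close> is open, because an automorphism that fixes a chamber
and its finitely many neighbours is special, and it is compact, because its orbits lie in finite
spheres around \<open>c\<close> (Tychonoff). The two conditions of tidiness then follow.

\<open>U = U\<^sub>+ U\<^sub>-\<close> (\<open>factorization\<close>): given \<open>u \<in> U\<close>, straightness of the line through \<open>c\<close> shows that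
\<open>u (t\<^sup>-\<^sup>N c)\<close> has the same distance to \<open>t\<^sup>N c\<close> as \<open>t\<^sup>-\<^sup>N c\<close>. Weyl-transitivity provides a special
element \<open>g\<close> of \<open>G\<close> that fixes \<open>t\<^sup>N c\<close> and agrees with \<open>u\<close> at \<open>t\<^sup>-\<^sup>N c\<close>. By rigidity \<open>g\<close> fixes
\<open>t\<^sup>n c\<close> and agrees with \<open>u\<close> at \<open>t\<^sup>-\<^sup>n c\<close> for all \<open>0 \<le> n \<le> N\<close>. Compactness of \<open>U\<close> yields one \<open>g\<close> that works for
every \<open>N\<close>, and \<open>u = g (g\<^sup>-\<^sup>1 u)\<close> is the factorization.

The union of the conjugates \<open>t\<^sup>-\<^sup>N U\<^sub>- t\<^sup>N\<close> is closed (\<open>closedin_eventual_fixers\<close>): it consists of the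
special elements fixing \<open>t\<^sup>-\<^sup>n c\<close> for all large \<open>n\<close>. By rigidity such an element lies in \<open>U\<^sub>-\<close> as soon as it
fixes \<open>c\<close>. So the union meets the open subgroup \<open>U\<close> in the closed set \<open>U\<^sub>-\<close>, and a subgroup with
this property is closed.\<close>

section \<open>Length in Coxeter systems\<close>

context coxeter_system
begin

abbreviation len :: "'a \<Rightarrow> nat" where
  "len w \<equiv> cox_length W S w"

abbreviation wprod :: "'a list \<Rightarrow> 'a" where
  "wprod ws \<equiv> word_prod W ws"

lemma gen_closed [simp]: "s \<in> S \<Longrightarrow> s \<in> carrier W"
  using gens_closed by blast

lemma gen_square [simp]: "s \<in> S \<Longrightarrow> s \<otimes> s = \<one>"
  using gens_involutions by blast

lemma gen_cancel_left [simp]: "s \<in> S \<Longrightarrow> w \<in> carrier W \<Longrightarrow> s \<otimes> (s \<otimes> w) = w"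
  by (simp flip: m_assoc)

lemma gen_cancel_right [simp]: "s \<in> S \<Longrightarrow> w \<in> carrier W \<Longrightarrow> w \<otimes> s \<otimes> s = w"
  by (simp add: m_assoc)

lemma inv_cancel_left [simp]:
  "v \<in> carrier W \<Longrightarrow> w \<in> carrier W \<Longrightarrow> inv v \<otimes> (v \<otimes> w) = w"
  by (simp flip: m_assoc)

lemma inv_gen [simp]: "s \<in> S \<Longrightarrow> inv s = s"
  by (rule inv_equality) auto

lemma wprod_Nil [simp]: "wprod [] = \<one>"
  by (simp add: word_prod_def)

lemma wprod_Cons [simp]: "wprod (w # ws) = w \<otimes> wprod ws"
  by (simp add: word_prod_def)

lemma wprod_closed [simp]: "ws \<in> lists S \<Longrightarrow> wprod ws \<in> carrier W"
  by (induction ws) auto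

lemma wprod_append [simp]:
  "us \<in> lists S \<Longrightarrow> vs \<in> lists S \<Longrightarrow> wprod (us @ vs) = wprod us \<otimes> wprod vs"
  by (induction us) (auto simp: m_assoc)

lemma wprod_rev: "ws \<in> lists S \<Longrightarrow> wprod (rev ws) = inv (wprod ws)"
  by (induction ws) (auto simp: inv_mult_group in_lists_conv_set)

lemma ex_word:
  assumes "w \<in> carrier W"
  shows "\<exists>ws \<in> lists S. wprod ws = w"
proof -
  have "w \<in> generate W S"
    using assms gens_generate by simp
  then show ?thesis
  proof (induction rule: generate.induct)
    case one
    show ?case by (rule bexI[of _ "[]"]) auto
  next
    case (incl h)
    then show ?case by (intro bexI[of _ "[h]"]) auto
  next
    case (inv h)
    then show ?case by (intro bexI[of _ "[h]"]) auto
  next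
    case (eng g h)
    then obtain us vs where "us \<in> lists S" "wprod us = g" "vs \<in> lists S" "wprod vs = h"
      by blast
    then show ?case by (intro bexI[of _ "us @ vs"]) auto
  qed
qed

lemma ex_reduced_word:
  assumes "w \<in> carrier W"
  obtains ws where "ws \<in> lists S" "wprod ws = w" "length ws = len w"
proof -
  obtain vs where "vs \<in> lists S" "wprod vs = w"
    using ex_word[OF assms] by blast
  then have "\<exists>ws \<in> lists S. length ws = length vs \<and> wprod ws = w"
    by blast
  then have "\<exists>ws \<in> lists S. length ws = len w \<and> wprod ws = w"
    unfolding cox_length_def by (rule LeastI)
  then show ?thesis using that by blast
qed

lemma len_wprod_le: "ws \<in> lists S \<Longrightarrow> len (wprod ws) \<le> length ws"
  unfolding cox_length_def by (rule Least_le) blast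

lemma len_one [simp]: "len \<one> = 0"
  using len_wprod_le[of "[]"] by simp

lemma len_mult_le:
  assumes "v \<in> carrier W" "w \<in> carrier W"
  shows "len (v \<otimes> w) \<le> len v + len w"
proof -
  obtain us where us: "us \<in> lists S" "wprod us = v" "length us = len v"
    using ex_reduced_word assms by blast
  obtain vs where vs: "vs \<in> lists S" "wprod vs = w" "length vs = len w"
    using ex_reduced_word assms by blast
  show ?thesis
    using len_wprod_le[of "us @ vs"] us vs by simp
qed

lemma len_gen_le: "s \<in> S \<Longrightarrow> len s \<le> 1"
  using len_wprod_le[of "[s]"] by simp

lemma len_inv:
  assumes "w \<in> carrier W"
  shows "len (inv w) = len w"
proof -
  have le: "len (inv v) \<le> len v" if v: "v \<in> carrier W" for v
  proof -
    obtain us where "us \<in> lists S" "wprod us = v" "length us = len v"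
      using ex_reduced_word v by blast
    then show ?thesis
      using len_wprod_le[of "rev us"] by (simp add: wprod_rev in_lists_conv_set)
  qed
  show ?thesis
    using le[of w] le[of "inv w"] assms by simp
qed

text \<open>All defining relations have even length. It follows that right multiplication by a
  generator changes the length by exactly one.\<close>

lemma length_parity:
  assumes "us \<in> lists S" "vs \<in> lists S" "wprod us = wprod vs"
  shows "even (length us) \<longleftrightarrow> even (length vs)"
proof -
  have "even (length us) \<longleftrightarrow> even (length vs)" if "cox_cong W S us vs" for us vs
    using that by induction (auto simp: length_concat sum_list_replicate)
  then show ?thesis
    using presentation assms by blast
qed

lemma len_mult_gen_neq:
  assumes "w \<in> carrier W" "s \<in> S"
  shows "len (w \<otimes> s) \<noteq> len w"
proof
  assume eq: "len (w \<otimes> s) = len w"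
  obtain us where us: "us \<in> lists S" "wprod us = w" "length us = len w"
    using ex_reduced_word assms by blast
  obtain vs where vs: "vs \<in> lists S" "wprod vs = w \<otimes> s" "length vs = len (w \<otimes> s)"
    using ex_reduced_word[of "w \<otimes> s"] assms by auto
  show False
    using length_parity[of "us @ [s]" vs] us vs assms eq by simp
qed

lemma len_mult_gen_cases:
  assumes "w \<in> carrier W" "s \<in> S"
  shows "len (w \<otimes> s) = len w + 1 \<or> len w = len (w \<otimes> s) + 1"
  using len_mult_le[of w s] len_mult_le[of "w \<otimes> s" s] len_gen_le[of s]
    len_mult_gen_neq[OF assms] assms by simp linarith

lemma reduced_subwords:
  assumes "us \<in> lists S" "vs \<in> lists S" "len (wprod (us @ vs)) = length (us @ vs)"
  shows "len (wprod us) = length us" "len (wprod vs) = length vs"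
  using len_mult_le[of "wprod us" "wprod vs"] len_wprod_le[of us] len_wprod_le[of vs] assms
  by simp_all

lemma mem_root_iff:
  assumes "g \<in> carrier W" "s \<in> S" "x \<in> carrier W"
  shows "x \<in> g <# simple_root W S s \<longleftrightarrow> len (inv g \<otimes> x) < len (s \<otimes> (inv g \<otimes> x))"
proof
  assume "x \<in> g <# simple_root W S s"
  then obtain y where "y \<in> simple_root W S s" "x = g \<otimes> y"
    by (auto simp: l_coset_def)
  then show "len (inv g \<otimes> x) < len (s \<otimes> (inv g \<otimes> x))"
    using assms by (auto simp: simple_root_def simp flip: m_assoc)
next
  assume "len (inv g \<otimes> x) < len (s \<otimes> (inv g \<otimes> x))"
  then have "inv g \<otimes> x \<in> simple_root W S s"
    using assms by (simp add: simple_root_def)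
  moreover have "x = g \<otimes> (inv g \<otimes> x)"
    using assms by (simp flip: m_assoc)
  ultimately show "x \<in> g <# simple_root W S s"
    unfolding l_coset_def by blast
qed

text \<open>The criterion behind straightness. Multiply \<open>v\<close> by the letters of a reduced word of \<open>w\<close>. If
  the length drops for the first time when the letter \<open>s\<close> takes \<open>u\<close> to \<open>u s\<close>, then the root
  \<open>u s \<alpha>\<^sub>s\<close>, the side of \<open>u s\<close> of the wall between \<open>u\<close> and \<open>u s\<close>, contains \<open>1\<close> and \<open>v w\<close> but not
  \<open>v\<close>: seen from \<open>u s\<close>, the elements \<open>v\<close> and \<open>v w\<close> are reached
  by reading that reduced word backwards, through \<open>s\<close>, and forwards, away from \<open>s\<close>.\<close>

lemma len_mult_eq_if_no_root_separates:
  assumes v: "v \<in> carrier W" and w: "w \<in> carrier W"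
    and roots: "\<And>r. r \<in> coxeter_roots W S \<Longrightarrow> \<one> \<in> r \<Longrightarrow> v \<otimes> w \<in> r \<Longrightarrow> v \<in> r"
  shows "len (v \<otimes> w) = len v + len w"
proof -
  obtain ts where ts: "ts \<in> lists S" "wprod ts = w" "length ts = len w"
    using ex_reduced_word w by blast
  have "len (v \<otimes> wprod us) = len v + length us" if "ts = us @ us'" for us us'
    using that
  proof (induction us arbitrary: us' rule: rev_induct)
    case Nil
    then show ?case using v by simp
  next
    case (snoc s us)
    define u where "u = v \<otimes> wprod us"
    have S: "us \<in> lists S" "s \<in> S" "us' \<in> lists S"
      using ts snoc.prems by auto
    have red: "len (wprod us) = length us" "len (wprod (us @ [s])) = length us + 1"
        "len (wprod us') = length us'" "len (wprod (s # us')) = length us' + 1"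
      using reduced_subwords[of us "s # us'"] reduced_subwords[of "us @ [s]" us'] S ts snoc.prems
      by simp_all
    have u: "u \<in> carrier W" "len u = len v + length us"
      using snoc S v by (simp_all add: u_def)
    \<comment> \<open>The side of \<open>u s\<close> of the wall between \<open>u\<close> and \<open>u s\<close>.\<close>
    define r where "r = (u \<otimes> s) <# simple_root W S s"
    have inv_us: "inv (u \<otimes> s) = s \<otimes> inv u"
      using S u by (simp add: inv_mult_group)
    have r: "r \<in> coxeter_roots W S"
      unfolding r_def coxeter_roots_def
      using S u by (intro CollectI exI[of _ "u \<otimes> s"] exI[of _ s]) auto
    have e1: "s \<otimes> inv u \<otimes> v = inv (wprod (us @ [s]))"
      using S v by (simp add: u_def inv_mult_group m_assoc)
    have "v \<notin> r"
    proof -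
      have "s \<otimes> (inv (u \<otimes> s) \<otimes> v) = inv (wprod us)"
        using S v by (simp add: u_def inv_mult_group m_assoc)
      then show ?thesis
        using S v u red by (simp add: r_def mem_root_iff inv_us e1 len_inv del: wprod_append)
    qed
    moreover have "v \<otimes> w \<in> r"
    proof -
      have "w = wprod us \<otimes> (s \<otimes> wprod us')"
        using snoc.prems ts S by auto
      then have "inv (u \<otimes> s) \<otimes> (v \<otimes> w) = wprod us'"
        using S v by (simp add: u_def inv_mult_group m_assoc inv_solve_left')
      then show ?thesis
        using S v w u red by (simp add: r_def mem_root_iff)
    qed
    \<comment> \<open>If the length dropped at this letter, \<open>r\<close> would also contain \<open>1\<close>.\<close>
    ultimately have "\<one> \<notin> r"
      using roots r by blast
    then have "\<not> len (u \<otimes> s) < len u"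
      using S u len_inv[of "u \<otimes> s"] len_inv[of u] by (simp add: r_def mem_root_iff inv_us)
    then have "len (u \<otimes> s) = len u + 1"
      using len_mult_gen_cases[of u s] S u by auto
    then show ?case
      using u S v by (simp add: u_def m_assoc)
  qed
  from this[of ts "[]"] show ?thesis
    using ts by simp
qed

end

section \<open>Minimal galleries in a building\<close>

context building
begin

lemma dist_self [simp]: "x \<in> C \<Longrightarrow> \<delta> x x = \<one>"
  using dist_one by simp

lemma adjacent_sym:
  assumes "x \<in> C" "y \<in> C" "\<delta> x y \<in> S"
  shows "\<delta> y x = \<delta> x y"
proof -
  have "\<delta> y y \<in> {\<delta> y x, \<delta> y x \<otimes> \<delta> x y}"
    using dist_step[of y x y] assms by blast
  moreover have "\<delta> y x \<noteq> \<one>"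
    using dist_one[of y x] dist_one[of x y] gens_involutions assms by metis
  ultimately have "\<delta> y x \<otimes> \<delta> x y = \<one>"
    using assms by auto
  then show ?thesis
    using assms dist_closed inv_equality[of "\<delta> y x" "\<delta> x y"] by simp
qed

lemma ex_closer_chamber:
  assumes "x \<in> C" "y \<in> C" "x \<noteq> y"
  obtains z where "z \<in> C" "\<delta> z y \<in> S" "\<delta> x y = \<delta> x z \<otimes> \<delta> z y"
    "len (\<delta> x y) = len (\<delta> x z) + 1"
proof -
  obtain ws where ws: "ws \<in> lists S" "wprod ws = \<delta> x y" "length ws = len (\<delta> x y)"
    using ex_reduced_word dist_closed assms by blast
  have "ws \<noteq> []"
    using ws dist_one[of x y] assms by auto
  then obtain us s where us: "ws = us @ [s]"
    by (meson rev_exhaust)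
  have S: "us \<in> lists S" "s \<in> S"
    using ws us by auto
  obtain z where z: "z \<in> C" "\<delta> y z = s" "\<delta> x z = \<delta> x y \<otimes> s"
    using dist_extend[of x y s] assms S by blast
  have xy: "\<delta> x y = wprod us \<otimes> s"
    using ws us S by simp
  then have "\<delta> x z = wprod us"
    using S z by simp
  note e = xy this
  have "len (wprod us) = length us"
    using reduced_subwords(1)[of us "[s]"] S ws us by simp
  then show ?thesis
    using that[of z] z S e adjacent_sym[of y z] assms ws us by simp
qed

text \<open>Induction along a minimal gallery that starts at a fixed chamber \<open>x\<close>: only the distances
  from \<open>x\<close> matter, so no list of chambers appears.\<close>

lemma gallery_induct [consumes 2, case_names start step]:
  assumes "x \<in> C" "y \<in> C"
    and start: "P x"
    and step: "\<And>y z. \<lbrakk>y \<in> C; z \<in> C; \<delta> y z \<in> S; \<delta> x z = \<delta> x y \<otimes> \<delta> y z;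
      len (\<delta> x z) = len (\<delta> x y) + 1; P y\<rbrakk> \<Longrightarrow> P z"
  shows "P y"
  using assms(2)
proof (induction "len (\<delta> x y)" arbitrary: y rule: less_induct)
  case less
  show ?case
  proof (cases "x = y")
    case True
    then show ?thesis using start by simp
  next
    case False
    then obtain z where "z \<in> C" "\<delta> z y \<in> S" "\<delta> x y = \<delta> x z \<otimes> \<delta> z y"
      "len (\<delta> x y) = len (\<delta> x z) + 1"
      using ex_closer_chamber assms(1) less.prems by metis
    then show ?thesis
      using step[of z y] less by simp
  qed
qed

lemma len_dist_step:
  assumes "x \<in> C" "y \<in> C" "z \<in> C" "\<delta> y z \<in> S"
  shows "len (\<delta> x z) \<le> len (\<delta> x y) + 1"
  using dist_step[OF assms] len_mult_le[of "\<delta> x y" "\<delta> y z"] len_gen_le[of "\<delta> y z"]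
    dist_closed assms by fastforce

lemma len_dist_triangle:
  assumes "x \<in> C" "y \<in> C" "z \<in> C"
  shows "len (\<delta> x z) \<le> len (\<delta> x y) + len (\<delta> y z)"
  using assms(2,3)
proof (induction rule: gallery_induct)
  case start
  then show ?case using assms by simp
next
  case (step z z')
  then show ?case using len_dist_step[of x z z'] assms by simp
qed

text \<open>For \<open>x\<close>, \<open>y\<close>, \<open>z\<close> in \<open>C\<close> this says that \<open>y\<close> lies on a minimal gallery from \<open>x\<close> to \<open>z\<close>: gallery
  distance is the length of the Weyl distance.\<close>

definition between :: "'c \<Rightarrow> 'c \<Rightarrow> 'c \<Rightarrow> bool" where
  "between x y z \<longleftrightarrow> len (\<delta> x z) = len (\<delta> x y) + len (\<delta> y z)"

text \<open>A gallery whose type is a reduced word has the product of that word as its distance, so two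
  minimal galleries with reduced composite type can be concatenated.\<close>

lemma dist_mult_if_reduced:
  assumes "x \<in> C" "y \<in> C" "z \<in> C"
    and "len (\<delta> x y \<otimes> \<delta> y z) = len (\<delta> x y) + len (\<delta> y z)"
  shows "\<delta> x z = \<delta> x y \<otimes> \<delta> y z"
  using assms(2,3,4)
proof (induction rule: gallery_induct)
  case start
  then show ?case using assms dist_closed by simp
next
  case (step z z')
  have cl: "\<delta> x y \<in> carrier W" "\<delta> y z \<in> carrier W" "\<delta> z z' \<in> carrier W"
    using dist_closed assms step by auto
  have "len (\<delta> x y \<otimes> \<delta> y z') \<le> len (\<delta> x y \<otimes> \<delta> y z) + 1"
    using len_mult_le[of "\<delta> x y \<otimes> \<delta> y z" "\<delta> z z'"] len_gen_le[of "\<delta> z z'"] step cl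
    by (simp add: m_assoc)
  then have eq: "len (\<delta> x y \<otimes> \<delta> y z) = len (\<delta> x y) + len (\<delta> y z)"
    using len_mult_le[of "\<delta> x y" "\<delta> y z"] cl step by linarith
  then have "\<delta> x z = \<delta> x y \<otimes> \<delta> y z"
    using step by blast
  moreover have "len (\<delta> x y \<otimes> \<delta> y z \<otimes> \<delta> z z') = len (\<delta> x y \<otimes> \<delta> y z) + 1"
    using eq step cl by (simp add: m_assoc)
  ultimately have "\<delta> x z' = \<delta> x y \<otimes> \<delta> y z \<otimes> \<delta> z z'"
    using dist_step[of x z z'] assms step by simp
  then show ?case
    using step cl by (simp add: m_assoc)
qed

text \<open>A gallery of length \<open>len (\<delta> x z)\<close> has to lengthen the distance from \<open>x\<close> at every step, and then each
  step multiplies this distance by the type of the step.\<close>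

lemma between_dist:
  assumes "x \<in> C" "y \<in> C" "z \<in> C" "between x y z"
  shows "\<delta> x z = \<delta> x y \<otimes> \<delta> y z"
  using assms(2,3,4)
proof (induction rule: gallery_induct)
  case start
  then show ?case using assms dist_closed by simp
next
  case (step z z')
  have cl: "\<delta> x y \<in> carrier W" "\<delta> y z \<in> carrier W" "\<delta> z z' \<in> carrier W"
    using dist_closed assms step by auto
  have len: "len (\<delta> x z') \<le> len (\<delta> x z) + 1" "len (\<delta> x z) \<le> len (\<delta> x y) + len (\<delta> y z)"
    using len_dist_step[of x z z'] len_dist_triangle[of x y z] assms step by auto
  then have "between x y z" "\<delta> x z' \<noteq> \<delta> x z"
    using step unfolding between_def by auto
  then have "\<delta> x z' = \<delta> x z \<otimes> \<delta> z z'" "\<delta> x z = \<delta> x y \<otimes> \<delta> y z"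
    using dist_step[of x z z'] assms step by auto
  then show ?case
    using step cl by (simp add: m_assoc)
qed

text \<open>Two such chambers \<open>y \<noteq> y'\<close> of one panel would be \<open>s\<close>-adjacent; going from \<open>y\<close> to \<open>y'\<close> would then
  lengthen the distance from \<open>x\<close> just as going from \<open>y\<close> to \<open>z\<close> does.\<close>

lemma closer_chamber_unique:
  assumes C: "x \<in> C" "z \<in> C" "y \<in> C" "y' \<in> C"
    and adj: "\<delta> y z \<in> S" "\<delta> y' z = \<delta> y z"
    and x: "\<delta> x y = \<delta> x y'" "\<delta> x z = \<delta> x y \<otimes> \<delta> y z" "len (\<delta> x z) = len (\<delta> x y) + 1"
  shows "y = y'"
proof (rule ccontr)
  assume "y \<noteq> y'"
  have "\<delta> z y' = \<delta> y z"
    using adjacent_sym[of y' z] C adj by simp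
  then have "\<delta> y y' \<in> {\<delta> y z, \<one>}"
    using dist_step[of y z y'] C adj by auto
  then have "\<delta> y y' = \<delta> y z"
    using dist_one[of y y'] C \<open>y \<noteq> y'\<close> by blast
  then have "\<delta> x y' = \<delta> x z"
    using dist_step[of x y y'] C adj x by simp
  then show False
    using x by simp
qed

text \<open>The source of all rigidity: a chamber on a minimal gallery is determined by the ends and its
  distance from the first end. The last steps of the two galleries from \<open>y\<close> and \<open>y'\<close> to \<open>z\<close> come from the
  same chamber, by the uniqueness of the chamber of a panel that is closer to \<open>x\<close>, and induction on
  the distance of \<open>y\<close> and \<open>z\<close> applies to that chamber in place of \<open>z\<close>.\<close>

lemma between_unique:
  assumes "x \<in> C" "z \<in> C" "y \<in> C" "y' \<in> C"
    and "between x y z" "between x y' z" "\<delta> x y = \<delta> x y'"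
  shows "y = y'"
  using assms(2-)
proof (induction "len (\<delta> y z)" arbitrary: z y y' rule: less_induct)
  case less
  have cl: "\<delta> x y \<in> carrier W" "\<delta> y z \<in> carrier W" "\<delta> y' z \<in> carrier W"
    using dist_closed assms(1) less.prems by auto
  have xz: "\<delta> x z = \<delta> x y \<otimes> \<delta> y z" "\<delta> x z = \<delta> x y' \<otimes> \<delta> y' z"
    using between_dist[of x y z] between_dist[of x y' z] assms(1) less.prems by auto
  have same: "\<delta> y' z = \<delta> y z"
    using xz less.prems cl by (metis inv_cancel_left)
  show ?case
  proof (cases "y = z")
    case True
    then show ?thesis
      using same dist_one[of y' z] less.prems by simp
  next
    case False
    obtain v where v: "v \<in> C" "\<delta> v z \<in> S" "\<delta> y z = \<delta> y v \<otimes> \<delta> v z"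
      "len (\<delta> y z) = len (\<delta> y v) + 1"
      using ex_closer_chamber False less.prems by metis
    define s where "s = \<delta> v z"
    have s: "s \<in> S" "\<delta> z v = s"
      using v adjacent_sym[of v z] less.prems by (simp_all add: s_def)
    have yv: "\<delta> y v \<in> carrier W"
      using dist_closed less.prems v by simp
    \<comment> \<open>\<open>v\<close> is the last chamber before \<open>z\<close> coming from \<open>y\<close>, and \<open>v'\<close> the one coming from \<open>y'\<close>.\<close>
    obtain v' where v': "v' \<in> C" "\<delta> z v' = s" "\<delta> y' v' = \<delta> y' z \<otimes> s"
      using dist_extend[of y' z s] less.prems s by blast
    have v'z: "\<delta> v' z = s" "\<delta> y' v' = \<delta> y v"
      using adjacent_sym[of z v'] v' s v less.prems yv same by (simp_all add: s_def)
    have "len (\<delta> x z) \<le> len (\<delta> x v) + 1" "len (\<delta> x z) \<le> len (\<delta> x v') + 1"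
      using len_dist_step[OF assms(1) v(1) less.prems(1) v(2)]
        len_dist_step[OF assms(1) v'(1) less.prems(1)] v'z(1) s(1) by blast+
    moreover have "len (\<delta> x v) \<le> len (\<delta> x y) + len (\<delta> y v)"
      using len_dist_triangle[OF assms(1) less.prems(2) v(1)] .
    moreover have "len (\<delta> x v') \<le> len (\<delta> x y) + len (\<delta> y v)"
      using len_dist_triangle[OF assms(1) less.prems(3) v'(1)]
      unfolding v'z(2) less.prems(6)[symmetric] .
    moreover have "len (\<delta> x z) = len (\<delta> x y) + len (\<delta> y v) + 1"
      using less.prems(4) v(4) unfolding between_def by linarith
    ultimately have len: "len (\<delta> x v) = len (\<delta> x y) + len (\<delta> y v)"
      "len (\<delta> x v') = len (\<delta> x y) + len (\<delta> y v)" "len (\<delta> x z) = len (\<delta> x v) + 1"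
      by linarith+
    have b: "between x y v"
      using len(1) unfolding between_def .
    have b': "between x y' v'"
      using len(2) unfolding between_def less.prems(6)[symmetric] v'z(2) .
    have xv: "\<delta> x v = \<delta> x y \<otimes> \<delta> y v"
      by (rule between_dist[OF assms(1) less.prems(2) v(1) b])
    have xv': "\<delta> x v' = \<delta> x v"
      using between_dist[OF assms(1) less.prems(3) v'(1) b']
      unfolding v'z(2) less.prems(6)[symmetric] xv .
    have "\<delta> x z = \<delta> x v \<otimes> \<delta> v z"
      unfolding xv xz(1) v(3) using cl yv v(2) by (simp add: m_assoc)
    moreover have "\<delta> v' z = \<delta> v z"
      using v'z(1) unfolding s_def .
    ultimately have "v = v'"
      using closer_chamber_unique[OF assms(1) less.prems(1) v(1) v'(1) v(2)] xv' len(3) by metis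
    moreover have "len (\<delta> y v) < len (\<delta> y z)"
      using v(4) by linarith
    ultimately show ?thesis
      using less.hyps[OF _ v(1) less.prems(2,3) b] b' less.prems(6) by metis
  qed
qed

lemma len_dist_less_gallery:
  assumes "gallery S C \<delta> x y xs"
  shows "len (\<delta> x y) < length xs"
  using assms
proof (induction xs arbitrary: y rule: rev_induct)
  case Nil
  then show ?case by (simp add: gallery_def)
next
  case (snoc z xs)
  show ?case
  proof (cases "xs = []")
    case True
    then show ?thesis using snoc.prems by (auto simp: gallery_def)
  next
    case False
    define y' where "y' = last xs"
    have g: "gallery S C \<delta> x y' xs" "z = y" "\<delta> y' y \<in> S"
      using snoc.prems False
      by (auto simp: gallery_def successively_append_iff y'_def)
    have "x \<in> C" "y' \<in> C" "y \<in> C"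
      using snoc.prems False by (auto simp: gallery_def y'_def)
    then show ?thesis
      using snoc.IH[OF g(1)] len_dist_step[of x y' y] g by simp
  qed
qed

lemma gallery_snoc:
  assumes "gallery S C \<delta> x y xs" "z \<in> C" "\<delta> y z \<in> S"
  shows "gallery S C \<delta> x z (xs @ [z])"
  using assms by (auto simp: gallery_def successively_append_iff)

lemma ex_gallery:
  assumes "x \<in> C" "y \<in> C"
  shows "\<exists>xs. gallery S C \<delta> x y xs \<and> length xs = len (\<delta> x y) + 1"
  using assms
proof (induction rule: gallery_induct)
  case start
  then show ?case
    using assms by (intro exI[of _ "[x]"]) (auto simp: gallery_def)
next
  case (step y z)
  then obtain xs where "gallery S C \<delta> x y xs" "length xs = len (\<delta> x y) + 1"
    by blast
  then show ?case
    using gallery_snoc[of x y xs z] step by (intro exI[of _ "xs @ [z]"]) simp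
qed

text \<open>Convexity speaks of galleries as lists; this is the form in which it is used: a minimal gallery
  between chambers of \<open>A\<close> can be walked back one chamber at a time without leaving \<open>A\<close>.\<close>

lemma closer_chamber_in_convex:
  assumes conv: "gallery_convex S C \<delta> A" and A: "x \<in> A" "z \<in> A"
    and y: "y \<in> C" "\<delta> y z \<in> S" "len (\<delta> x z) = len (\<delta> x y) + 1"
  shows "y \<in> A"
proof -
  have C: "x \<in> C" "z \<in> C"
    using conv A by (auto simp: gallery_convex_def)
  obtain xs where xs: "gallery S C \<delta> x y xs" "length xs = len (\<delta> x y) + 1"
    using ex_gallery C y by blast
  have "gallery S C \<delta> x z (xs @ [z])"
    using gallery_snoc xs C y by blast
  then have "minimal_gallery S C \<delta> x z (xs @ [z])"
    unfolding minimal_gallery_def using len_dist_less_gallery xs y by fastforce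
  then have "set (xs @ [z]) \<subseteq> A"
    using conv A unfolding gallery_convex_def by blast
  moreover have "y \<in> set xs"
    using xs(1) by (auto simp: gallery_def)
  ultimately show ?thesis by auto
qed

section \<open>Apartments and translations\<close>

lemma mem_panel:
  assumes "s \<in> S" "\<delta> x y = s" "y \<in> C"
  shows "y \<in> residue W C \<delta> {s} x"
  using assms by (auto simp: residue_def intro: generate.incl)

lemma apartment_subset: "apartment W S C \<delta> A \<Longrightarrow> A \<subseteq> C"
  by (simp add: apartment_def gallery_convex_def)

text \<open>If multiplication by \<open>s = \<delta> y z\<close> lengthens \<open>\<delta> x y\<close>, this is an axiom. Otherwise the chamber \<open>z'\<close> of
  the \<open>s\<close>-panel of \<open>y\<close> that is closer to \<open>x\<close> belongs to \<open>A\<close> by convexity, and since the panel has only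
  two chambers in \<open>A\<close>, it is \<open>z\<close>.\<close>

lemma apartment_dist_step:
  assumes ap: "apartment W S C \<delta> A" and A: "x \<in> A" "y \<in> A" "z \<in> A" and adj: "\<delta> y z \<in> S"
  shows "\<delta> x z = \<delta> x y \<otimes> \<delta> y z"
proof -
  have C: "x \<in> C" "y \<in> C" "z \<in> C"
    using apartment_subset[OF ap] A by auto
  define s where "s = \<delta> y z"
  have s: "s \<in> S" and xy: "\<delta> x y \<in> carrier W"
    using adj C dist_closed by (simp_all add: s_def)
  consider "len (\<delta> x y \<otimes> s) = len (\<delta> x y) + 1" | "len (\<delta> x y) = len (\<delta> x y \<otimes> s) + 1"
    using len_mult_gen_cases[OF xy s] by blast
  then show ?thesis
  proof cases
    case 1
    then show ?thesis
      using dist_step[of x y z] C adj by (simp add: s_def)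
  next
    case 2
    obtain z' where z': "z' \<in> C" "\<delta> y z' = s" "\<delta> x z' = \<delta> x y \<otimes> s"
      using dist_extend[of x y s] C s by blast
    have "z' \<in> A"
      using closer_chamber_in_convex[of A x y z'] ap A z' s 2 adjacent_sym[of y z'] C
      by (simp add: apartment_def)
    define P where "P = residue W C \<delta> {s} y"
    have yP: "y \<in> P"
      using C by (simp add: P_def residue_def generate.one)
    have "P \<in> panels W S C \<delta>"
      using C s by (auto simp: P_def panels_def)
    moreover have "y \<in> P \<inter> A"
      using A yP by blast
    ultimately have "card (P \<inter> A) = 2"
      using ap by (auto simp: apartment_def)
    then obtain a b where "P \<inter> A = {a, b}"
      by (meson card_2_iff)
    moreover have "z \<in> P" "z' \<in> P"
      using mem_panel[of s y] C z' s by (auto simp: P_def s_def)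
    moreover have "z \<noteq> y" "z' \<noteq> y"
      using s z' C gens_involutions[of s] by (auto simp: s_def)
    moreover have "y \<in> P \<inter> A" "z \<in> P \<inter> A" "z' \<in> P \<inter> A"
      using A \<open>z' \<in> A\<close> yP calculation by auto
    ultimately have "z = z'"
      by auto
    then show ?thesis
      using z' by (simp add: s_def)
  qed
qed

lemma apartment_dist:
  assumes ap: "apartment W S C \<delta> A" and A: "x \<in> A" "y \<in> A" "z \<in> A"
  shows "\<delta> x z = \<delta> x y \<otimes> \<delta> y z"
proof -
  have C: "x \<in> C" "y \<in> C" "z \<in> C"
    using apartment_subset[OF ap] A by auto
  have "z \<in> A \<longrightarrow> \<delta> x z = \<delta> x y \<otimes> \<delta> y z"
    using C(2,3)
  proof (induction rule: gallery_induct)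
    case start
    then show ?case using C dist_closed by simp
  next
    case (step z z')
    show ?case
    proof
      assume z': "z' \<in> A"
      then have z: "z \<in> A"
        using closer_chamber_in_convex[of A y z' z] ap A step by (simp add: apartment_def)
      then have "\<delta> x z' = \<delta> x z \<otimes> \<delta> z z'" "\<delta> x z = \<delta> x y \<otimes> \<delta> y z"
        using apartment_dist_step[OF ap A(1) z z'] step by auto
      then show "\<delta> x z' = \<delta> x y \<otimes> \<delta> y z'"
        using step C dist_closed by (simp add: m_assoc)
    qed
  qed
  then show ?thesis using A by blast
qed

lemma between_if_no_root_separates:
  assumes ap: "apartment W S C \<delta> A" and A: "x \<in> A" "y \<in> A" "z \<in> A"
    and roots: "\<And>\<alpha>. \<lbrakk>\<alpha> \<in> apartment_roots W S \<delta> A; x \<in> \<alpha>; z \<in> \<alpha>\<rbrakk> \<Longrightarrow> y \<in> \<alpha>"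
  shows "between x y z"
proof -
  have C: "x \<in> C" "y \<in> C" "z \<in> C"
    using apartment_subset[OF ap] A by auto
  have xz: "\<delta> x z = \<delta> x y \<otimes> \<delta> y z"
    using apartment_dist[OF ap A] .
  have "\<delta> x y \<in> r" if "r \<in> coxeter_roots W S" "\<one> \<in> r" "\<delta> x y \<otimes> \<delta> y z \<in> r" for r
  proof -
    have "{a \<in> A. \<delta> x a \<in> r} \<in> apartment_roots W S \<delta> A"
      using that A by (auto simp: apartment_roots_def)
    then show ?thesis
      using roots[of "{a \<in> A. \<delta> x a \<in> r}"] that A C xz by simp
  qed
  then show ?thesis
    using len_mult_eq_if_no_root_separates[of "\<delta> x y" "\<delta> y z"] dist_closed C xz
    by (simp add: between_def)
qed

text \<open>For a root \<open>\<alpha>\<close> with \<open>t \<alpha> \<subseteq> \<alpha>\<close> the orbit of a chamber of \<open>\<alpha>\<close> stays in \<open>\<alpha>\<close>; for \<open>\<alpha> \<subseteq> t \<alpha>\<close> a point of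
  the orbit that lies in \<open>\<alpha>\<close> has all its predecessors in \<open>\<alpha>\<close>. In both cases an orbit that is in \<open>\<alpha>\<close> at the
  times \<open>0\<close> and \<open>n\<close> is in \<open>\<alpha>\<close> at all times between them, so no root separates.\<close>

lemma translation_orbit_between:
  assumes ap: "apartment W S C \<delta> A" and tr: "apartment_translation W S \<delta> A (restrict t A)"
    and inj: "inj_on t A" and tA: "t ` A = A" and b: "b \<in> A" and mn: "m \<le> n"
  shows "between b ((t ^^ m) b) ((t ^^ n) b)"
proof -
  have mem: "(t ^^ k) b \<in> A" for k
    using b tA by (induction k) auto
  show ?thesis
  proof (rule between_if_no_root_separates[OF ap b mem mem])
    fix \<alpha> assume \<alpha>: "\<alpha> \<in> apartment_roots W S \<delta> A" and ends: "b \<in> \<alpha>" "(t ^^ n) b \<in> \<alpha>"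
    have \<alpha>A: "\<alpha> \<subseteq> A"
      using \<alpha> by (auto simp: apartment_roots_def)
    then have im: "restrict t A ` \<alpha> = t ` \<alpha>"
      by (auto simp: subset_iff image_iff)
    consider "t ` \<alpha> \<subseteq> \<alpha>" | "\<alpha> \<subseteq> t ` \<alpha>"
      using tr \<alpha> im unfolding apartment_translation_def parallel_roots_def by metis
    then show "(t ^^ m) b \<in> \<alpha>"
    proof cases
      case 1
      then show ?thesis using ends by (induction m) auto
    next
      case 2
      show ?thesis
        using mn
      proof (induction rule: inc_induct)
        case base
        show ?case by (rule ends)
      next
        case (step k)
        then have "t ((t ^^ k) b) \<in> t ` \<alpha>"
          using 2 by auto
        then show ?case
          using inj \<alpha>A mem by (meson inj_on_image_mem_iff)
      qed
    qed
  qed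
qed

end

section \<open>The permutation topology\<close>

locale permutation_group =
  fixes C :: "'c set" and G :: "('c \<Rightarrow> 'c) set"
  assumes subgroup_Bij: "subgroup G (BijGroup C)"
begin

abbreviation Grp :: "('c \<Rightarrow> 'c) monoid" where
  "Grp \<equiv> (BijGroup C)\<lparr>carrier := G\<rparr>"

abbreviation Top :: "('c \<Rightarrow> 'c) topology" where
  "Top \<equiv> perm_topology Grp C"

sublocale Grp: group Grp
  using subgroup.subgroup_is_group[OF subgroup_Bij group_BijGroup] .

lemma in_Bij [simp]: "g \<in> G \<Longrightarrow> g \<in> Bij C"
  using subgroup.subset[OF subgroup_Bij] by (auto simp: BijGroup_def)

lemma apply_closed [simp]: "g \<in> G \<Longrightarrow> x \<in> C \<Longrightarrow> g x \<in> C"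
  using Bij_imp_funcset[OF in_Bij] by blast

lemma perm_eqI: "f \<in> G \<Longrightarrow> g \<in> G \<Longrightarrow> (\<And>x. x \<in> C \<Longrightarrow> f x = g x) \<Longrightarrow> f = g"
  using extensionalityI Bij_imp_extensional in_Bij by metis

lemma mult_apply [simp]: "f \<in> G \<Longrightarrow> g \<in> G \<Longrightarrow> x \<in> C \<Longrightarrow> (f \<otimes>\<^bsub>BijGroup C\<^esub> g) x = f (g x)"
  by (simp add: BijGroup_def compose_def)

lemma one_apply [simp]: "x \<in> C \<Longrightarrow> \<one>\<^bsub>BijGroup C\<^esub> x = x"
  by (simp add: BijGroup_def)

lemma mult_in [simp]: "f \<in> G \<Longrightarrow> g \<in> G \<Longrightarrow> f \<otimes>\<^bsub>BijGroup C\<^esub> g \<in> G"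
  using Grp.m_closed by simp

lemma inv_in [simp]: "g \<in> G \<Longrightarrow> inv\<^bsub>Grp\<^esub> g \<in> G"
  using Grp.inv_closed by simp

lemma one_in [simp]: "\<one>\<^bsub>BijGroup C\<^esub> \<in> G"
  using Grp.one_closed by simp

lemma inv_apply [simp]:
  assumes "g \<in> G" "x \<in> C"
  shows "(inv\<^bsub>Grp\<^esub> g) (g x) = x" "g ((inv\<^bsub>Grp\<^esub> g) x) = x"
proof -
  have "(inv\<^bsub>Grp\<^esub> g \<otimes>\<^bsub>Grp\<^esub> g) x = x" "(g \<otimes>\<^bsub>Grp\<^esub> inv\<^bsub>Grp\<^esub> g) x = x"
    using assms Grp.l_inv[of g] Grp.r_inv[of g] by (simp_all del: mult_apply)
  then show "(inv\<^bsub>Grp\<^esub> g) (g x) = x" "g ((inv\<^bsub>Grp\<^esub> g) x) = x"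
    using assms by simp_all
qed

lemma apply_eq_iff [simp]: "g \<in> G \<Longrightarrow> x \<in> C \<Longrightarrow> y \<in> C \<Longrightarrow> g x = g y \<longleftrightarrow> x = y"
  by (metis inv_apply(1))

text \<open>The basic neighbourhoods of \<open>g\<close> consist of the permutations that agree with \<open>g\<close> on a finite set.
  All topological arguments below use this description.\<close>

lemma coset_stab_eq:
  assumes "g \<in> G" "F \<subseteq> C"
  shows "g <#\<^bsub>Grp\<^esub> pointwise_stab G F = {h \<in> G. \<forall>x \<in> F. h x = g x}" (is "?L = ?R")
proof
  show "?L \<subseteq> ?R"
    using assms by (auto simp: l_coset_def pointwise_stab_def subset_iff)
  show "?R \<subseteq> ?L"
  proof
    fix h assume h: "h \<in> ?R"
    then have "inv\<^bsub>Grp\<^esub> g \<otimes>\<^bsub>Grp\<^esub> h \<in> pointwise_stab G F"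
      using assms by (auto simp: pointwise_stab_def subset_iff)
    moreover have "h = g \<otimes>\<^bsub>Grp\<^esub> (inv\<^bsub>Grp\<^esub> g \<otimes>\<^bsub>Grp\<^esub> h)"
      using h assms by (intro perm_eqI) auto
    ultimately show "h \<in> ?L"
      unfolding l_coset_def by blast
  qed
qed

lemma openin_Top_iff:
  "openin Top V \<longleftrightarrow> V \<subseteq> G \<and>
     (\<forall>g \<in> V. \<exists>F. finite F \<and> F \<subseteq> C \<and> (\<forall>h \<in> G. (\<forall>x \<in> F. h x = g x) \<longrightarrow> h \<in> V))"
proof -
  have *: "(g <#\<^bsub>Grp\<^esub> pointwise_stab G F \<subseteq> V) \<longleftrightarrow> (\<forall>h \<in> G. (\<forall>x \<in> F. h x = g x) \<longrightarrow> h \<in> V)"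
    if "g \<in> G" "F \<subseteq> C" for g F
    unfolding coset_stab_eq[OF that] by blast
  have carrier: "carrier Grp = G"
    by simp
  show ?thesis
    unfolding openin_perm_topology carrier
    by (intro conj_cong ball_cong ex_cong1 refl *) auto
qed

lemma topspace_Top [simp]: "topspace Top = G"
proof -
  have "openin Top G" by (auto simp: openin_Top_iff)
  then show ?thesis
    using openin_subset openin_topspace openin_Top_iff by (metis subset_antisym)
qed

lemma closedin_Top_iff:
  "closedin Top K \<longleftrightarrow> K \<subseteq> G \<and>
     (\<forall>g \<in> G. (\<forall>F. finite F \<longrightarrow> F \<subseteq> C \<longrightarrow> (\<exists>h \<in> K. \<forall>x \<in> F. h x = g x)) \<longrightarrow> g \<in> K)"
proof (cases "K \<subseteq> G")
  case True
  then have "(\<forall>h \<in> G. (\<forall>x \<in> F. h x = g x) \<longrightarrow> h \<in> G - K) \<longleftrightarrow> \<not> (\<exists>h \<in> K. \<forall>x \<in> F. h x = g x)"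
    for F g
    by blast
  then have "openin Top (G - K) \<longleftrightarrow> (\<forall>g \<in> G - K. \<exists>F. finite F \<and> F \<subseteq> C \<and>
      \<not> (\<exists>h \<in> K. \<forall>x \<in> F. h x = g x))"
    unfolding openin_Top_iff by simp
  then show ?thesis
    unfolding closedin_def topspace_Top using True by (simp add: Ball_def) metis
qed (simp add: closedin_def)

lemma closedin_agreement:
  assumes "x \<in> C"
  shows "closedin Top {g \<in> G. g x = y}"
  unfolding closedin_Top_iff
proof (intro conjI ballI impI)
  fix g assume "g \<in> G"
    and "\<forall>F. finite F \<longrightarrow> F \<subseteq> C \<longrightarrow> (\<exists>h \<in> {g \<in> G. g x = y}. \<forall>x \<in> F. h x = g x)"
  then show "g \<in> {g \<in> G. g x = y}"
    using assms by (auto dest!: spec[of _ "{x}"])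
qed auto

text \<open>By Tychonoff the product of the orbits, as finite discrete spaces, is compact. The group \<open>K\<close> is
  closed in it: a limit of elements of \<open>K\<close> is injective and maps each orbit into itself, hence, the
  orbits being finite, is a bijection, and the hypothesis on limits applies. On \<open>K\<close> the product
  topology is at least as fine as the permutation topology.\<close>

lemma compactin_if_finite_orbits:
  assumes K: "subgroup K (BijGroup C)" "K \<subseteq> G"
    and orbits: "\<And>x. x \<in> C \<Longrightarrow> finite ((\<lambda>k. k x) ` K)"
    and limits: "\<And>f. f \<in> Bij C \<Longrightarrow>
      (\<And>F. finite F \<Longrightarrow> F \<subseteq> C \<Longrightarrow> \<exists>k \<in> K. \<forall>x \<in> F. k x = f x) \<Longrightarrow> f \<in> K"
  shows "compactin Top K"
proof -
  interpret K: permutation_group C K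
    using K(1) by (rule permutation_group.intro)
  define orb where "orb x = (\<lambda>k. k x) ` K" for x
  define X where "X = product_topology (\<lambda>x. discrete_topology (orb x)) C"
  have X: "topspace X = PiE C orb"
    by (simp add: X_def)
  have "compact_space X"
    unfolding X_def using orbits
    by (simp add: compact_space_product_topology compact_space_discrete_topology orb_def)
  have KX: "K \<subseteq> topspace X"
    using Bij_imp_extensional[OF K.in_Bij] by (auto simp: X orb_def PiE_def)
  have cyl: "openin X {f \<in> topspace X. \<forall>x \<in> F. f x = a x}" if "finite F" "F \<subseteq> C" for F a
    using that
  proof (induction F rule: finite_induct)
    case (insert y F)
    have "openin X {f \<in> topspace X. f y \<in> {a y} \<inter> orb y}"
      using insert.prems unfolding X_def
      by (intro openin_continuous_map_preimage[OF continuous_map_product_projection]) auto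
    then have "openin X ({f \<in> topspace X. f y \<in> {a y} \<inter> orb y} \<inter> {f \<in> topspace X. \<forall>x \<in> F. f x = a x})"
      using insert by blast
    moreover have "{f \<in> topspace X. f y \<in> {a y} \<inter> orb y} \<inter> {f \<in> topspace X. \<forall>x \<in> F. f x = a x}
        = {f \<in> topspace X. \<forall>x \<in> insert y F. f x = a x}"
      using insert.prems by (auto simp: X)
    ultimately show ?case by simp
  qed simp
  have approx_in_K: "f \<in> K" if f: "f \<in> topspace X"
      and approx: "\<And>F. finite F \<Longrightarrow> F \<subseteq> C \<Longrightarrow> \<exists>k \<in> K. \<forall>x \<in> F. k x = f x" for f
  proof (rule limits[OF _ approx])
    have inj: "inj_on f C"
    proof (rule inj_onI)
      fix x y assume xy: "x \<in> C" "y \<in> C" "f x = f y"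
      then obtain k where "k \<in> K" "k x = f x" "k y = f y"
        using approx[of "{x, y}"] by auto
      then show "x = y"
        using xy K.apply_eq_iff[of k x y] by simp
    qed
    have "f ` C = C"
    proof
      show "f ` C \<subseteq> C"
        using f by (auto simp: X orb_def PiE_iff)
      show "C \<subseteq> f ` C"
      proof
        fix y assume y: "y \<in> C"
        have orbC: "orb y \<subseteq> C"
          using y by (auto simp: orb_def)
        have "f ` orb y \<subseteq> orb y"
        proof
          fix z assume "z \<in> f ` orb y"
          then obtain g where g: "g \<in> K" "z = f (g y)"
            by (auto simp: orb_def)
          then obtain k where "k \<in> K" "k (g y) = z"
            using approx[of "{g y}"] y by auto
          then have "z = (k \<otimes>\<^bsub>BijGroup C\<^esub> g) y" "k \<otimes>\<^bsub>BijGroup C\<^esub> g \<in> K"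
            using g y by simp_all
          then show "z \<in> orb y"
            unfolding orb_def by blast
        qed
        then have "f ` orb y = orb y"
          using inj orbC orbits[OF y] by (intro endo_inj_surj) (auto simp: orb_def inj_on_subset)
        moreover have "y \<in> orb y"
          using K.one_apply[OF y] K.one_in unfolding orb_def by (metis image_eqI)
        ultimately show "y \<in> f ` C"
          using orbC by blast
      qed
    qed
    then show "f \<in> Bij C"
      using f inj by (auto simp: X Bij_def PiE_def bij_betw_def)
  qed
  have "closedin X K"
    unfolding closedin_def
  proof (intro conjI KX)
    show "openin X (topspace X - K)"
    proof (subst openin_subopen, intro ballI)
      fix f assume f: "f \<in> topspace X - K"
      then obtain F where F: "finite F" "F \<subseteq> C" "\<not> (\<exists>k \<in> K. \<forall>x \<in> F. k x = f x)"
        using approx_in_K by blast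
      then show "\<exists>T. openin X T \<and> f \<in> T \<and> T \<subseteq> topspace X - K"
        using f cyl[OF F(1,2), of f]
        by (intro exI[of _ "{h \<in> topspace X. \<forall>x \<in> F. h x = f x}"]) blast
    qed
  qed
  then have "compactin X K"
    using closedin_compact_space \<open>compact_space X\<close> by blast
  then have cK: "compactin (subtopology X K) K"
    by (simp add: compactin_subtopology)
  have "continuous_map (subtopology X K) Top id"
    unfolding continuous_map_def
  proof (intro conjI allI impI)
    show "id \<in> topspace (subtopology X K) \<rightarrow> topspace Top"
      using K by auto
    fix V assume V: "openin Top V"
    show "openin (subtopology X K) {f \<in> topspace (subtopology X K). id f \<in> V}"
    proof (subst openin_subopen, intro ballI)
      fix f assume f: "f \<in> {f \<in> topspace (subtopology X K). id f \<in> V}"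
      then obtain F where F: "finite F" "F \<subseteq> C"
          "\<And>h. h \<in> G \<Longrightarrow> (\<forall>x \<in> F. h x = f x) \<Longrightarrow> h \<in> V"
        using V by (auto simp: openin_Top_iff)
      define T where "T = {h \<in> topspace X. \<forall>x \<in> F. h x = f x} \<inter> K"
      have "openin (subtopology X K) T"
        using cyl[OF F(1,2), of f] by (auto simp: openin_subtopology T_def)
      moreover have "f \<in> T" "T \<subseteq> {f \<in> topspace (subtopology X K). id f \<in> V}"
        using f F K by (auto simp: T_def)
      ultimately show "\<exists>T. openin (subtopology X K) T \<and> f \<in> T \<and>
          T \<subseteq> {f \<in> topspace (subtopology X K). id f \<in> V}"
        by blast
    qed
  qed
  from image_compactin[OF cK this] show ?thesis
    by simp
qed

lemma subtopology_Top:
  assumes "subgroup H (BijGroup C)" "H \<subseteq> G"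
  shows "subtopology Top H = perm_topology ((BijGroup C)\<lparr>carrier := H\<rparr>) C"
proof -
  interpret H: permutation_group C H
    using assms(1) by (rule permutation_group.intro)
  have "openin (subtopology Top H) V \<longleftrightarrow> openin H.Top V" for V
  proof
    assume "openin (subtopology Top H) V"
    then obtain V' where V': "openin Top V'" "V = V' \<inter> H"
      by (auto simp: openin_subtopology)
    show "openin H.Top V"
      unfolding H.openin_Top_iff
    proof (intro conjI ballI)
      fix g assume "g \<in> V"
      then obtain F where "finite F" "F \<subseteq> C" "\<forall>h \<in> G. (\<forall>x \<in> F. h x = g x) \<longrightarrow> h \<in> V'"
        using V' unfolding openin_Top_iff by blast
      then show "\<exists>F. finite F \<and> F \<subseteq> C \<and> (\<forall>h \<in> H. (\<forall>x \<in> F. h x = g x) \<longrightarrow> h \<in> V)"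
        using assms(2) V'(2) by (intro exI[of _ F]) auto
    qed (simp add: V')
  next
    assume V: "openin H.Top V"
    define V' where "V' = {h \<in> G. \<exists>F. finite F \<and> F \<subseteq> C \<and>
      (\<forall>k \<in> H. (\<forall>x \<in> F. k x = h x) \<longrightarrow> k \<in> V)}"
    have "openin Top V'"
      unfolding openin_Top_iff
    proof (intro conjI ballI)
      fix g assume "g \<in> V'"
      then obtain F where F: "finite F" "F \<subseteq> C" "\<forall>k \<in> H. (\<forall>x \<in> F. k x = g x) \<longrightarrow> k \<in> V"
        by (auto simp: V'_def)
      then show "\<exists>F. finite F \<and> F \<subseteq> C \<and> (\<forall>h \<in> G. (\<forall>x \<in> F. h x = g x) \<longrightarrow> h \<in> V')"
        unfolding V'_def by (intro exI[of _ F]) auto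
    qed (auto simp: V'_def)
    moreover have "V = V' \<inter> H"
    proof
      show "V \<subseteq> V' \<inter> H"
        using V assms(2) unfolding V'_def H.openin_Top_iff by fast
      show "V' \<inter> H \<subseteq> V"
        unfolding V'_def by blast
    qed
    ultimately show "openin (subtopology Top H) V"
      by (auto simp: openin_subtopology)
  qed
  then show ?thesis
    by (simp add: topology_eq)
qed

definition conj_by :: "('c \<Rightarrow> 'c) \<Rightarrow> ('c \<Rightarrow> 'c) \<Rightarrow> ('c \<Rightarrow> 'c)" where
  "conj_by t = (\<lambda>x \<in> G. t \<otimes>\<^bsub>Grp\<^esub> x \<otimes>\<^bsub>Grp\<^esub> inv\<^bsub>Grp\<^esub> t)"

lemma conj_by_in [simp]: "t \<in> G \<Longrightarrow> g \<in> G \<Longrightarrow> conj_by t g \<in> G"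
  by (simp add: conj_by_def)

lemma conj_by_apply [simp]:
  "t \<in> G \<Longrightarrow> g \<in> G \<Longrightarrow> x \<in> C \<Longrightarrow> conj_by t g (t x) = t (g x)"
  by (simp add: conj_by_def)

lemma conj_by_inverse:
  assumes "t \<in> G" "g \<in> G"
  shows "conj_by t (conj_by (inv\<^bsub>Grp\<^esub> t) g) = g" "conj_by (inv\<^bsub>Grp\<^esub> t) (conj_by t g) = g"
  using assms by (auto simp: conj_by_def intro!: perm_eqI)

text \<open>Tidiness is phrased with the inverse function of the conjugation; it is the conjugation by the
  inverse.\<close>

lemma inv_into_conj_by:
  assumes "t \<in> G" "g \<in> G"
  shows "inv_into G (conj_by t) g = conj_by (inv\<^bsub>Grp\<^esub> t) g"
proof (rule inv_into_f_eq)
  show "inj_on (conj_by t) G"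
    using conj_by_inverse(2)[OF assms(1)] by (metis inj_onI)
qed (use assms conj_by_inverse in auto)

end

section \<open>Automorphisms of a building\<close>

lemma Bij_apply: "f \<in> Bij C \<Longrightarrow> x \<in> C \<Longrightarrow> f x \<in> C"
  using Bij_imp_funcset by blast

lemma Bij_ex_preimage: "f \<in> Bij C \<Longrightarrow> y \<in> C \<Longrightarrow> \<exists>x \<in> C. f x = y"
  by (auto simp: Bij_def bij_betw_def image_iff set_eq_iff) metis

lemma Bij_mult_apply:
  "f \<in> Bij C \<Longrightarrow> g \<in> Bij C \<Longrightarrow> x \<in> C \<Longrightarrow> (f \<otimes>\<^bsub>BijGroup C\<^esub> g) x = f (g x)"
  by (simp add: BijGroup_def compose_def)

lemma Bij_mult_closed: "f \<in> Bij C \<Longrightarrow> g \<in> Bij C \<Longrightarrow> f \<otimes>\<^bsub>BijGroup C\<^esub> g \<in> Bij C"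
  by (simp add: BijGroup_def compose_Bij)

lemma Bij_inv_closed: "f \<in> Bij C \<Longrightarrow> inv\<^bsub>BijGroup C\<^esub> f \<in> Bij C"
  by (simp add: inv_BijGroup restrict_inv_into_Bij)

lemma Bij_inv_apply: "f \<in> Bij C \<Longrightarrow> x \<in> C \<Longrightarrow> (inv\<^bsub>BijGroup C\<^esub> f) (f x) = x"
  by (simp add: inv_BijGroup Bij_apply) (simp add: Bij_def bij_betw_def)

lemma diagram_perm_comp:
  "diagram_perm W S \<sigma> \<Longrightarrow> diagram_perm W S \<tau> \<Longrightarrow> diagram_perm W S (\<sigma> \<circ> \<tau>)"
  by (auto simp: diagram_perm_def bij_betw_trans bij_betw_apply)

lemma diagram_perm_inv:
  assumes "diagram_perm W S \<sigma>"
  shows "diagram_perm W S (inv_into S \<sigma>)"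
proof -
  have \<sigma>: "bij_betw \<sigma> S S"
    using assms by (simp add: diagram_perm_def)
  have "inv_into S \<sigma> s \<in> S" "\<sigma> (inv_into S \<sigma> s) = s" if "s \<in> S" for s
    using bij_betw_apply[OF bij_betw_inv_into[OF \<sigma>] that] bij_betw_inv_into_right[OF \<sigma> that]
    by simp_all
  then show ?thesis
    using assms bij_betw_inv_into[OF \<sigma>] unfolding diagram_perm_def by metis
qed

lemma sigma_iso_comp:
  assumes "sigma_iso S \<delta> \<sigma> C C f" "sigma_iso S \<delta> \<tau> C C g" "bij_betw \<tau> S S"
    and h: "bij_betw h C C" "\<And>x. x \<in> C \<Longrightarrow> h x = f (g x)"
  shows "sigma_iso S \<delta> (\<sigma> \<circ> \<tau>) C C h"
  unfolding sigma_iso_def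
proof (intro conjI ballI h)
  fix x y s assume *: "x \<in> C" "y \<in> C" "s \<in> S"
  then have "\<delta> x y = s \<longleftrightarrow> \<delta> (g x) (g y) = \<tau> s"
    using assms(2) by (simp add: sigma_iso_def)
  also have "\<dots> \<longleftrightarrow> \<delta> (f (g x)) (f (g y)) = \<sigma> (\<tau> s)"
    using assms(1-3) * unfolding sigma_iso_def by (metis bij_betw_apply)
  finally show "\<delta> x y = s \<longleftrightarrow> \<delta> (h x) (h y) = (\<sigma> \<circ> \<tau>) s"
    using h(2) * by simp
qed

lemma sigma_iso_inv:
  assumes f: "sigma_iso S \<delta> \<sigma> C C f" "bij_betw \<sigma> S S"
    and h: "bij_betw h C C" "\<And>x. x \<in> C \<Longrightarrow> h (f x) = x"
  shows "sigma_iso S \<delta> (inv_into S \<sigma>) C C h"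
  unfolding sigma_iso_def
proof (intro conjI ballI h)
  fix x y s assume "x \<in> C" "y \<in> C" "s \<in> S"
  moreover have "f ` C = C" "\<sigma> ` S = S"
    using f by (auto simp: sigma_iso_def bij_betw_def)
  ultimately obtain x' y' s' where *: "x' \<in> C" "x = f x'" "y' \<in> C" "y = f y'" "s' \<in> S" "s = \<sigma> s'"
    by (metis imageE)
  moreover have "inv_into S \<sigma> s = s'"
    using * f(2) by (auto simp: bij_betw_def)
  ultimately show "\<delta> x y = s \<longleftrightarrow> \<delta> (h x) (h y) = inv_into S \<sigma> s"
    using f(1) h(2) by (simp add: sigma_iso_def)
qed

context building
begin

lemma auts_Bij: "f \<in> auts W S \<delta> C \<Longrightarrow> f \<in> Bij C"
  by (simp add: auts_def)

lemma subgroup_auts: "subgroup (auts W S \<delta> C) (BijGroup C)"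
proof (rule group.subgroupI[OF group_BijGroup])
  show "auts W S \<delta> C \<subseteq> carrier (BijGroup C)"
    by (auto simp: BijGroup_def auts_def)
  have "diagram_perm W S id"
    by (simp add: diagram_perm_def)
  moreover have "sigma_iso S \<delta> id C C (\<lambda>x \<in> C. x)"
    using id_Bij[of C] by (simp add: sigma_iso_def Bij_def)
  ultimately show "auts W S \<delta> C \<noteq> {}"
    using id_Bij[of C] unfolding auts_def by blast
next
  fix f assume f: "f \<in> auts W S \<delta> C"
  then obtain \<sigma> where \<sigma>: "diagram_perm W S \<sigma>" "sigma_iso S \<delta> \<sigma> C C f"
    by (auto simp: auts_def)
  have "sigma_iso S \<delta> (inv_into S \<sigma>) C C (inv\<^bsub>BijGroup C\<^esub> f)"
    using \<sigma> f Bij_inv_closed[of f C] Bij_inv_apply[of f C] auts_Bij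
    by (intro sigma_iso_inv) (auto simp: diagram_perm_def Bij_def)
  then show "inv\<^bsub>BijGroup C\<^esub> f \<in> auts W S \<delta> C"
    using \<sigma> f Bij_inv_closed diagram_perm_inv unfolding auts_def by blast
next
  fix f g assume fg: "f \<in> auts W S \<delta> C" "g \<in> auts W S \<delta> C"
  then obtain \<sigma> \<tau> where \<sigma>: "diagram_perm W S \<sigma>" "sigma_iso S \<delta> \<sigma> C C f"
    "diagram_perm W S \<tau>" "sigma_iso S \<delta> \<tau> C C g"
    by (auto simp: auts_def)
  have "sigma_iso S \<delta> (\<sigma> \<circ> \<tau>) C C (f \<otimes>\<^bsub>BijGroup C\<^esub> g)"
    using \<sigma> fg Bij_mult_closed[of f C g] Bij_mult_apply[of f C g] auts_Bij
    by (intro sigma_iso_comp[OF \<sigma>(2,4)]) (auto simp: diagram_perm_def Bij_def)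
  then show "f \<otimes>\<^bsub>BijGroup C\<^esub> g \<in> auts W S \<delta> C"
    using \<sigma> fg Bij_mult_closed diagram_perm_comp unfolding auts_def by blast
qed

text \<open>A special automorphism is defined by its effect on adjacent chambers. It preserves all Weyl
  distances, because the distance along a minimal gallery is the product of its steps.\<close>

lemma special_auts_iff:
  "g \<in> special_auts S \<delta> C \<longleftrightarrow> g \<in> Bij C \<and> (\<forall>x \<in> C. \<forall>y \<in> C. \<delta> (g x) (g y) = \<delta> x y)"
proof
  assume g: "g \<in> special_auts S \<delta> C"
  then have Bij: "g \<in> Bij C"
    by (simp add: special_auts_def)
  have adj: "\<delta> x y = s \<longleftrightarrow> \<delta> (g x) (g y) = s" if "x \<in> C" "y \<in> C" "s \<in> S" for x y s
    using g that by (simp add: special_auts_def sigma_iso_def)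
  have "\<delta> (g x) (g y) = \<delta> x y" if "x \<in> C" "y \<in> C" for x y
    using that
  proof (induction rule: gallery_induct)
    case start
    then show ?case using that Bij_apply[OF Bij] by simp
  next
    case (step y z)
    have "\<delta> (g y) (g z) = \<delta> y z"
      using adj step by blast
    then have "\<delta> (g x) (g z) = \<delta> (g x) (g y) \<otimes> \<delta> (g y) (g z)"
      using dist_step[of "g x" "g y" "g z"] step that Bij_apply[OF Bij] by simp
    then show ?case
      using step \<open>\<delta> (g y) (g z) = \<delta> y z\<close> by simp
  qed
  then show "g \<in> Bij C \<and> (\<forall>x \<in> C. \<forall>y \<in> C. \<delta> (g x) (g y) = \<delta> x y)"
    using Bij by blast
next
  assume "g \<in> Bij C \<and> (\<forall>x \<in> C. \<forall>y \<in> C. \<delta> (g x) (g y) = \<delta> x y)"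
  then show "g \<in> special_auts S \<delta> C"
    by (auto simp: special_auts_def sigma_iso_def Bij_def)
qed

lemma special_auts_dist:
  "g \<in> special_auts S \<delta> C \<Longrightarrow> x \<in> C \<Longrightarrow> y \<in> C \<Longrightarrow> \<delta> (g x) (g y) = \<delta> x y"
  by (simp add: special_auts_iff)

lemma special_auts_subset_auts: "special_auts S \<delta> C \<subseteq> auts W S \<delta> C"
  by (auto simp: special_auts_def auts_def diagram_perm_def intro!: exI[of _ id])

text \<open>Special automorphisms preserve distances, so the images of \<open>y\<close> lie on minimal galleries with
  the same ends and at the same distance from the first end.\<close>

lemma special_auts_agree_between:
  assumes gh: "g \<in> special_auts S \<delta> C" "h \<in> special_auts S \<delta> C"
    and C: "x \<in> C" "y \<in> C" "z \<in> C" and btw: "between x y z"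
    and ends: "g x = h x" "g z = h z"
  shows "g y = h y"
proof (rule between_unique)
  have cl: "g a \<in> C" "h a \<in> C" if "a \<in> C" for a
    using gh that by (auto simp: special_auts_iff Bij_apply)
  show "g x \<in> C" "g z \<in> C" "g y \<in> C" "h y \<in> C"
    using cl C by auto
  show "between (g x) (g y) (g z)"
    using btw C gh by (simp add: between_def special_auts_dist)
  show "between (g x) (h y) (g z)"
    using btw C gh ends by (simp add: between_def special_auts_dist)
  show "\<delta> (g x) (g y) = \<delta> (g x) (h y)"
    using C gh ends(1) special_auts_dist[of g x y] special_auts_dist[of h x y] by simp
qed

text \<open>Whether an automorphism is special can be read off at one chamber and its neighbours, since every
  generator occurs as a distance there.\<close>

lemma special_if_agrees_near_chamber:
  assumes g: "g \<in> auts W S \<delta> C" and h: "h \<in> special_auts S \<delta> C" and c: "c \<in> C"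
    and agree: "g c = h c" "\<And>x. x \<in> C \<Longrightarrow> \<delta> c x \<in> S \<Longrightarrow> g x = h x"
  shows "g \<in> special_auts S \<delta> C"
proof -
  obtain \<sigma> where \<sigma>: "sigma_iso S \<delta> \<sigma> C C g"
    using g by (auto simp: auts_def)
  have "\<sigma> s = s" if s: "s \<in> S" for s
  proof -
    obtain x where x: "x \<in> C" "\<delta> c x = s"
      using dist_extend[of c c s] c s by auto
    then have "\<delta> (g c) (g x) = \<sigma> s"
      using \<sigma> c s by (simp add: sigma_iso_def)
    moreover have "\<delta> (h c) (h x) = s"
      using special_auts_dist h c x by simp
    ultimately show ?thesis
      using agree x s by simp
  qed
  then have "sigma_iso S \<delta> id C C g"
    using \<sigma> by (simp add: sigma_iso_def)
  then show ?thesis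
    using auts_Bij[OF g] by (simp add: special_auts_def)
qed

text \<open>The map \<open>h\<close> is the conjugate of \<open>g\<close> by \<open>t\<close>, so this is normality of the group of special
  automorphisms.\<close>

lemma special_conj:
  assumes t: "t \<in> auts W S \<delta> C" and g: "g \<in> special_auts S \<delta> C"
    and h: "h \<in> Bij C" "\<And>x. x \<in> C \<Longrightarrow> h (t x) = t (g x)"
  shows "h \<in> special_auts S \<delta> C"
proof -
  obtain \<sigma> where \<sigma>: "bij_betw \<sigma> S S" "sigma_iso S \<delta> \<sigma> C C t"
    using t by (auto simp: auts_def diagram_perm_def)
  have "\<delta> x y = s \<longleftrightarrow> \<delta> (h x) (h y) = s" if "x \<in> C" "y \<in> C" and s: "s \<in> S" for x y s
  proof -
    obtain x' y' where x'y': "x' \<in> C" "t x' = x" "y' \<in> C" "t y' = y"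
      using Bij_ex_preimage[OF auts_Bij[OF t] \<open>x \<in> C\<close>]
        Bij_ex_preimage[OF auts_Bij[OF t] \<open>y \<in> C\<close>] by blast
    obtain s' where s': "s' \<in> S" "\<sigma> s' = s"
      using \<sigma>(1) s unfolding bij_betw_def by (metis imageE)
    have gC: "g x' \<in> C" "g y' \<in> C"
      using g x'y' by (auto simp: special_auts_iff Bij_apply)
    have "\<delta> x y = s \<longleftrightarrow> \<delta> x' y' = s'"
      using \<sigma>(2) x'y' s' by (auto simp: sigma_iso_def)
    also have "\<dots> \<longleftrightarrow> \<delta> (g x') (g y') = s'"
      using special_auts_dist[OF g] x'y' by simp
    also have "\<dots> \<longleftrightarrow> \<delta> (t (g x')) (t (g y')) = s"
      using \<sigma>(2) gC s' by (auto simp: sigma_iso_def)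
    also have "\<dots> \<longleftrightarrow> \<delta> (h x) (h y) = s"
      using h(2) x'y' by metis
    finally show ?thesis .
  qed
  then show ?thesis
    using h(1) by (simp add: special_auts_def sigma_iso_def Bij_def)
qed

lemma finite_neighbours:
  assumes lf: "locally_finite W S C \<delta>" and "x \<in> C" "s \<in> S"
  shows "finite {y \<in> C. \<delta> x y = s}"
proof (rule finite_subset)
  show "{y \<in> C. \<delta> x y = s} \<subseteq> residue W C \<delta> {s} x"
    using mem_panel assms by blast
  show "finite (residue W C \<delta> {s} x)"
    using assms unfolding locally_finite_def panels_def by blast
qed

lemma finite_sphere:
  assumes lf: "locally_finite W S C \<delta>" and x: "x \<in> C" and w: "w \<in> carrier W"
  shows "finite {y \<in> C. \<delta> x y = w}"
proof -
  obtain ws where "ws \<in> lists S" "wprod ws = w"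
    using ex_word w by blast
  moreover have "finite {y \<in> C. \<delta> x y = wprod ws}" if "ws \<in> lists S" for ws
    using that
  proof (induction ws rule: rev_induct)
    case Nil
    have "{y \<in> C. \<delta> x y = wprod []} \<subseteq> {x}"
      using dist_one x by auto
    then show ?case by (rule finite_subset) simp
  next
    case (snoc s ws)
    then have S: "ws \<in> lists S" "s \<in> S" by auto
    have "{y \<in> C. \<delta> x y = wprod (ws @ [s])} \<subseteq>
        (\<Union>z \<in> {z \<in> C. \<delta> x z = wprod ws}. {y \<in> C. \<delta> z y = s})"
    proof
      fix y assume "y \<in> {y \<in> C. \<delta> x y = wprod (ws @ [s])}"
      then have y: "y \<in> C" "\<delta> x y = wprod ws \<otimes> s"
        using S by auto
      obtain z where "z \<in> C" "\<delta> y z = s" "\<delta> x z = \<delta> x y \<otimes> s"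
        using dist_extend[of x y s] x y S by blast
      then show "y \<in> (\<Union>z \<in> {z \<in> C. \<delta> x z = wprod ws}. {y \<in> C. \<delta> z y = s})"
        using adjacent_sym[of y z] y S by auto
    qed
    moreover have "finite \<dots>"
      using snoc.IH finite_neighbours[OF lf] S by auto
    ultimately show ?case
      by (rule finite_subset)
  qed
  ultimately show ?thesis by blast
qed

end

section \<open>Closed automorphism groups of locally finite buildings\<close>

locale building_group = building W S C \<delta> for W (structure) and S and C :: "'c set" and \<delta> +
  fixes G :: "('c \<Rightarrow> 'c) set"
  assumes finite_gens: "finite S"
    and loc_finite: "locally_finite W S C \<delta>"
    and subgroup_aut: "subgroup G (aut_group W S C \<delta>)"
    and closed_aut: "closedin (perm_topology (aut_group W S C \<delta>) C) G"
begin

lemma G_subset_auts: "G \<subseteq> auts W S \<delta> C"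
  using subgroup.subset[OF subgroup_aut] by (simp add: aut_group_def)

lemma aut_group_update: "(aut_group W S C \<delta>)\<lparr>carrier := G\<rparr> = (BijGroup C)\<lparr>carrier := G\<rparr>"
  by (simp add: aut_group_def)

end

sublocale building_group \<subseteq> permutation_group C G
  using group.incl_subgroup[OF group_BijGroup subgroup_auts] subgroup_aut
  by (intro permutation_group.intro) (simp add: aut_group_def)

context building_group
begin

lemma subtopology_aut: "subtopology (perm_topology (aut_group W S C \<delta>) C) G = Top"
proof -
  interpret A: permutation_group C "auts W S \<delta> C"
    using subgroup_auts by (rule permutation_group.intro)
  show ?thesis
    using A.subtopology_Top[OF subgroup_Bij G_subset_auts] by (simp add: aut_group_def)
qed

lemma mem_G_if_limit:
  assumes "f \<in> auts W S \<delta> C"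
    and "\<And>F. finite F \<Longrightarrow> F \<subseteq> C \<Longrightarrow> \<exists>g \<in> G. \<forall>x \<in> F. g x = f x"
  shows "f \<in> G"
proof -
  interpret A: permutation_group C "auts W S \<delta> C"
    using subgroup_auts by (rule permutation_group.intro)
  show ?thesis
    using closed_aut assms unfolding aut_group_def A.closedin_Top_iff by blast
qed

definition special_fix :: "'c set \<Rightarrow> ('c \<Rightarrow> 'c) set" where
  "special_fix Y = {g \<in> G \<inter> special_auts S \<delta> C. \<forall>y \<in> Y. g y = y}"

lemma special_mult:
  "f \<in> G \<inter> special_auts S \<delta> C \<Longrightarrow> g \<in> G \<inter> special_auts S \<delta> C \<Longrightarrow>
    f \<otimes>\<^bsub>BijGroup C\<^esub> g \<in> special_auts S \<delta> C"
  using in_Bij[OF mult_in] by (simp add: special_auts_iff)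

lemma special_inv:
  assumes "g \<in> G \<inter> special_auts S \<delta> C"
  shows "inv\<^bsub>Grp\<^esub> g \<in> special_auts S \<delta> C"
proof -
  have "\<delta> ((inv\<^bsub>Grp\<^esub> g) x) ((inv\<^bsub>Grp\<^esub> g) y) = \<delta> x y" if "x \<in> C" "y \<in> C" for x y
    using assms that special_auts_dist[of g "(inv\<^bsub>Grp\<^esub> g) x" "(inv\<^bsub>Grp\<^esub> g) y"] by simp
  then show ?thesis
    using assms in_Bij[OF inv_in] by (simp add: special_auts_iff)
qed

lemma special_fix_mult: "f \<in> special_fix Y \<Longrightarrow> g \<in> special_fix Y \<Longrightarrow> Y \<subseteq> C \<Longrightarrow> f \<otimes>\<^bsub>BijGroup C\<^esub> g \<in> special_fix Y"
  using special_mult by (auto simp: special_fix_def subset_iff)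

lemma special_fix_inv: "g \<in> special_fix Y \<Longrightarrow> Y \<subseteq> C \<Longrightarrow> inv\<^bsub>Grp\<^esub> g \<in> special_fix Y"
  using special_inv inv_apply(1) unfolding special_fix_def by (fastforce simp: subset_iff)

lemma subgroup_special_fix:
  assumes "Y \<subseteq> C"
  shows "subgroup (special_fix Y) Grp"
proof (rule Grp.subgroupI)
  have "\<one>\<^bsub>BijGroup C\<^esub> \<in> special_fix Y"
    using in_Bij[OF one_in] assms by (auto simp: special_fix_def special_auts_iff subset_iff)
  then show "special_fix Y \<noteq> {}" by blast
qed (use special_fix_mult special_fix_inv assms in \<open>auto simp: special_fix_def\<close>)

lemma subgroup_special_fix_Bij: "Y \<subseteq> C \<Longrightarrow> subgroup (special_fix Y) (BijGroup C)"
  using group.incl_subgroup[OF group_BijGroup subgroup_Bij subgroup_special_fix] .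

lemma conj_by_special_fix_subset:
  assumes "t \<in> G" "Y \<subseteq> C"
  shows "conj_by t ` special_fix Y \<subseteq> special_fix (t ` Y)"
proof
  fix h assume "h \<in> conj_by t ` special_fix Y"
  then obtain g where g: "g \<in> special_fix Y" "h = conj_by t g"
    by blast
  then have "g \<in> G" "g \<in> special_auts S \<delta> C"
    by (auto simp: special_fix_def)
  then have "h \<in> special_auts S \<delta> C"
    using special_conj[of t g h] assms(1) G_subset_auts g in_Bij[OF conj_by_in] by auto
  then show "h \<in> special_fix (t ` Y)"
    using g assms by (auto simp: special_fix_def subset_iff)
qed

lemma conj_by_special_fix:
  assumes "t \<in> G" "Y \<subseteq> C"
  shows "conj_by t ` special_fix Y = special_fix (t ` Y)"
proof
  show "special_fix (t ` Y) \<subseteq> conj_by t ` special_fix Y"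
  proof
    fix h assume h: "h \<in> special_fix (t ` Y)"
    have tY: "t ` Y \<subseteq> C"
      using assms by auto
    have "(inv\<^bsub>Grp\<^esub> t) ` t ` Y = Y"
      using assms by (force simp: image_image subset_iff)
    then have "conj_by (inv\<^bsub>Grp\<^esub> t) h \<in> special_fix Y"
      using conj_by_special_fix_subset[OF inv_in[OF assms(1)], of "t ` Y"] h tY imageI by fastforce
    moreover have "h = conj_by t (conj_by (inv\<^bsub>Grp\<^esub> t) h)"
      using h assms conj_by_inverse(1) by (simp add: special_fix_def)
    ultimately show "h \<in> conj_by t ` special_fix Y"
      by blast
  qed
qed (rule conj_by_special_fix_subset[OF assms])

lemma inv_conj_by_special_fix:
  assumes "t \<in> G" "Y \<subseteq> C"
  shows "inv_into G (conj_by t) ` special_fix Y = special_fix ((inv\<^bsub>Grp\<^esub> t) ` Y)"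
proof -
  have "inv_into G (conj_by t) ` special_fix Y = conj_by (inv\<^bsub>Grp\<^esub> t) ` special_fix Y"
    using inv_into_conj_by[OF assms(1)] by (intro image_cong) (auto simp: special_fix_def)
  then show ?thesis
    using conj_by_special_fix assms by simp
qed

lemma funpow_closed: "g \<in> G \<Longrightarrow> x \<in> C \<Longrightarrow> (g ^^ n) x \<in> C"
  by (induction n) auto

text \<open>By these two identities the sets \<open>U\<^sub>+\<close> and \<open>U\<^sub>-\<close> and the conjugates of \<open>U\<^sub>-\<close> are pointwise
  stabilizers of pieces of the orbit of a chamber.\<close>

lemma conj_by_funpow_special_fix:
  assumes "t \<in> G" "Y \<subseteq> C"
  shows "(conj_by t ^^ n) ` special_fix Y = special_fix ((t ^^ n) ` Y)"
proof (induction n)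
  case (Suc n)
  have "(conj_by t ^^ Suc n) ` special_fix Y = conj_by t ` ((conj_by t ^^ n) ` special_fix Y)"
    by (simp add: image_image)
  also have "\<dots> = conj_by t ` special_fix ((t ^^ n) ` Y)"
    by (simp only: Suc)
  also have "\<dots> = special_fix (t ` (t ^^ n) ` Y)"
    using assms funpow_closed by (intro conj_by_special_fix) auto
  finally show ?case
    by (simp add: image_image)
qed simp

lemma inv_conj_by_funpow_special_fix:
  assumes "t \<in> G" "Y \<subseteq> C"
  shows "(inv_into G (conj_by t) ^^ n) ` special_fix Y = special_fix (((inv\<^bsub>Grp\<^esub> t) ^^ n) ` Y)"
proof (induction n)
  case (Suc n)
  have "(inv_into G (conj_by t) ^^ Suc n) ` special_fix Y
      = inv_into G (conj_by t) ` ((inv_into G (conj_by t) ^^ n) ` special_fix Y)"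
    by (simp add: image_image)
  also have "\<dots> = inv_into G (conj_by t) ` special_fix (((inv\<^bsub>Grp\<^esub> t) ^^ n) ` Y)"
    by (simp only: Suc)
  also have "\<dots> = special_fix ((inv\<^bsub>Grp\<^esub> t) ` ((inv\<^bsub>Grp\<^esub> t) ^^ n) ` Y)"
    using assms funpow_closed by (intro inv_conj_by_special_fix) auto
  finally show ?case
    by (simp add: image_image)
qed simp

definition near :: "'c \<Rightarrow> 'c set" where
  "near c = insert c {x \<in> C. \<delta> c x \<in> S}"

lemma near_subset: "c \<in> C \<Longrightarrow> near c \<subseteq> C"
  by (auto simp: near_def)

lemma finite_near:
  assumes "c \<in> C"
  shows "finite (near c)"
proof -
  have "{x \<in> C. \<delta> c x \<in> S} = (\<Union>s \<in> S. {x \<in> C. \<delta> c x = s})"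
    by blast
  then show ?thesis
    using finite_neighbours[OF loc_finite assms] finite_gens by (simp add: near_def)
qed

lemma special_if_agrees_near:
  assumes "g \<in> auts W S \<delta> C" "h \<in> special_auts S \<delta> C" "c \<in> C" "\<forall>x \<in> near c. h x = g x"
  shows "g \<in> special_auts S \<delta> C"
  using special_if_agrees_near_chamber[OF assms(1-3)] assms(4) by (auto simp: near_def)

lemma special_limit:
  assumes "g \<in> auts W S \<delta> C"
    and "\<And>F. finite F \<Longrightarrow> F \<subseteq> C \<Longrightarrow> \<exists>h \<in> special_auts S \<delta> C. \<forall>x \<in> F. h x = g x"
  shows "g \<in> special_auts S \<delta> C"
proof -
  obtain c where c: "c \<in> C"
    using chambers_nonempty by blast
  then show ?thesis
    using special_if_agrees_near[OF assms(1) _ c] assms(2)[OF finite_near near_subset] by blast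
qed

lemma closedin_special_fix:
  assumes "Y \<subseteq> C"
  shows "closedin Top (special_fix Y)"
  unfolding closedin_Top_iff
proof (intro conjI ballI impI)
  fix g assume g: "g \<in> G"
    and lim: "\<forall>F. finite F \<longrightarrow> F \<subseteq> C \<longrightarrow> (\<exists>h \<in> special_fix Y. \<forall>x \<in> F. h x = g x)"
  have "g \<in> special_auts S \<delta> C"
    using special_limit[of g] g G_subset_auts lim unfolding special_fix_def by blast
  moreover have "g y = y" if "y \<in> Y" for y
    using lim[rule_format, of "{y}"] that assms by (auto simp: special_fix_def)
  ultimately show "g \<in> special_fix Y"
    using g by (simp add: special_fix_def)
qed (auto simp: special_fix_def)

text \<open>Specialness is visible near \<open>c\<close>, so an element of \<open>G\<close> that agrees near \<open>c\<close> with an element of the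
  stabilizer belongs to it.\<close>

lemma openin_chamber_stab:
  assumes "c \<in> C"
  shows "openin Top (special_fix {c})"
  unfolding openin_Top_iff
proof (intro conjI ballI)
  fix g assume g: "g \<in> special_fix {c}"
  have "h \<in> special_fix {c}" if h: "h \<in> G" "\<forall>x \<in> near c. h x = g x" for h
  proof -
    have "h \<in> special_auts S \<delta> C"
      using special_if_agrees_near[of h g c] h g G_subset_auts assms by (auto simp: special_fix_def)
    then show ?thesis
      using h g by (simp add: special_fix_def near_def)
  qed
  then show "\<exists>F. finite F \<and> F \<subseteq> C \<and> (\<forall>h \<in> G. (\<forall>x \<in> F. h x = g x) \<longrightarrow> h \<in> special_fix {c})"
    using finite_near near_subset assms by blast
qed (auto simp: special_fix_def)

text \<open>Special elements fixing \<open>c\<close> preserve the spheres around \<open>c\<close>, which are finite by local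
  finiteness; and limits of such elements stay in \<open>G\<close> because \<open>G\<close> is closed.\<close>

lemma compactin_chamber_stab:
  assumes c: "c \<in> C"
  shows "compactin Top (special_fix {c})"
proof (rule compactin_if_finite_orbits)
  show "subgroup (special_fix {c}) (BijGroup C)"
    using subgroup_special_fix_Bij c by simp
  show "special_fix {c} \<subseteq> G"
    by (auto simp: special_fix_def)
  show "finite ((\<lambda>k. k x) ` special_fix {c})" if x: "x \<in> C" for x
  proof (rule finite_subset)
    show "(\<lambda>k. k x) ` special_fix {c} \<subseteq> {y \<in> C. \<delta> c y = \<delta> c x}"
    proof
      fix y assume "y \<in> (\<lambda>k. k x) ` special_fix {c}"
      then obtain k where k: "k \<in> G" "k \<in> special_auts S \<delta> C" "k c = c" "y = k x"
        by (auto simp: special_fix_def)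
      then show "y \<in> {y \<in> C. \<delta> c y = \<delta> c x}"
        using special_auts_dist[OF k(2) c x] x by simp
    qed
    show "finite {y \<in> C. \<delta> c y = \<delta> c x}"
      using finite_sphere[OF loc_finite c] dist_closed c x by simp
  qed
next
  fix f assume f: "f \<in> Bij C"
    and lim: "\<And>F. finite F \<Longrightarrow> F \<subseteq> C \<Longrightarrow> \<exists>k \<in> special_fix {c}. \<forall>x \<in> F. k x = f x"
  have "\<delta> (f x) (f y) = \<delta> x y" if "x \<in> C" "y \<in> C" for x y
  proof -
    obtain k where "k \<in> special_fix {c}" "k x = f x" "k y = f y"
      using lim[of "{x, y}"] \<open>x \<in> C\<close> \<open>y \<in> C\<close> by auto
    then show ?thesis
      using special_auts_dist[of k x y] that by (simp add: special_fix_def)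
  qed
  then have special: "f \<in> special_auts S \<delta> C"
    using f by (simp add: special_auts_iff)
  moreover have "f \<in> G"
  proof (rule mem_G_if_limit)
    show "f \<in> auts W S \<delta> C"
      using special special_auts_subset_auts by blast
    show "\<exists>g \<in> G. \<forall>x \<in> F. g x = f x" if "finite F" "F \<subseteq> C" for F
      using lim[OF that] by (auto simp: special_fix_def)
  qed
  moreover have "f c = c"
    using lim[of "{c}"] c by (auto simp: special_fix_def)
  ultimately show "f \<in> special_fix {c}"
    by (simp add: special_fix_def)
qed

end

section \<open>Tidiness along a straight orbit\<close>

text \<open>All that the rest of the proof needs to know about the translation \<open>t\<close> of the apartment is that
  its orbits are straight. The base point \<open>b\<close> varies over \<open>A\<close>, so that straightness of the
  two-sided orbit of \<open>c\<close> can be obtained by starting far back in it.\<close>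

locale straight_element = building_group W S C \<delta> G
  for W (structure) and S and C :: "'c set" and \<delta> and G +
  fixes A :: "'c set" and t :: "'c \<Rightarrow> 'c"
  assumes A_subset: "A \<subseteq> C"
    and t_in: "t \<in> G"
    and t_image: "t ` A = A"
    and straight: "\<lbrakk>b \<in> A; m \<le> n\<rbrakk> \<Longrightarrow> between b ((t ^^ m) b) ((t ^^ n) b)"
begin

abbreviation fwd :: "nat \<Rightarrow> 'c \<Rightarrow> 'c" where
  "fwd n \<equiv> t ^^ n"

abbreviation bwd :: "nat \<Rightarrow> 'c \<Rightarrow> 'c" where
  "bwd n \<equiv> (inv\<^bsub>Grp\<^esub> t) ^^ n"

lemma fwd_in: "b \<in> A \<Longrightarrow> fwd n b \<in> A"
  using t_image by (induction n) auto

lemma bwd_in: "b \<in> A \<Longrightarrow> bwd n b \<in> A"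
proof (induction n)
  case (Suc n)
  then obtain a where "a \<in> A" "bwd n b = t a"
    using t_image by blast
  then show ?case
    using t_in A_subset by (auto simp: subset_iff)
qed simp

lemma fwd_bwd: "b \<in> A \<Longrightarrow> fwd k (bwd (k + m) b) = bwd m b"
proof (induction k)
  case (Suc k)
  have "t (bwd (Suc (k + m)) b) = bwd (k + m) b"
    using Suc.prems bwd_in[of b "k + m"] t_in A_subset by (auto simp: subset_iff)
  then show ?case
    using Suc by (simp only: funpow_Suc_right o_apply add_Suc)
qed simp

lemma between_fwd: "b \<in> A \<Longrightarrow> m \<le> n \<Longrightarrow> between b (fwd m b) (fwd n b)"
  by (rule straight)

lemma between_bwd:
  assumes "b \<in> A" "m \<le> n"
  shows "between (bwd n b) (bwd m b) b"
  using straight[OF bwd_in[OF assms(1)], of "n - m" n n]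
    fwd_bwd[OF assms(1), of "n - m" m] fwd_bwd[OF assms(1), of n 0] assms(2) by simp

lemma between_bwd_fwd:
  assumes "b \<in> A"
  shows "between (bwd n b) b (fwd n b)"
  using straight[OF bwd_in[OF assms], of n "n + n" n] fwd_bwd[OF assms, of n 0]
  by (simp add: funpow_add)

lemma agree_on_bwd_ray:
  assumes c: "c \<in> A" and g: "g \<in> special_auts S \<delta> C" "h \<in> special_auts S \<delta> C"
    and agree: "g c = h c" "g (bwd N c) = h (bwd N c)" and "n \<le> N"
  shows "g (bwd n c) = h (bwd n c)"
  using special_auts_agree_between[OF g, of "bwd N c" "bwd n c" c]
    between_bwd[OF c \<open>n \<le> N\<close>] agree c bwd_in[OF c] A_subset by blast

lemma agree_on_fwd_ray:
  assumes c: "c \<in> A" and g: "g \<in> special_auts S \<delta> C" "h \<in> special_auts S \<delta> C"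
    and agree: "g c = h c" "g (fwd N c) = h (fwd N c)" and "n \<le> N"
  shows "g (fwd n c) = h (fwd n c)"
  using special_auts_agree_between[OF g, of c "fwd n c" "fwd N c"]
    between_fwd[OF c \<open>n \<le> N\<close>] agree c fwd_in[OF c] A_subset by blast

text \<open>The factor \<open>u\<^sub>+\<close> of \<open>u = u\<^sub>+ u\<^sub>-\<close> up to stage \<open>N\<close>. As \<open>c\<close> lies on a minimal gallery from
  \<open>x = t\<^sup>-\<^sup>N c\<close> to \<open>z = t\<^sup>N c\<close> and \<open>u\<close> preserves the distance from \<open>x\<close> to \<open>c\<close>, the chambers \<open>x\<close> and \<open>u x\<close>
  have the same distance to \<open>z\<close>. Weyl-transitivity moves one pair to the other, and rigidity controls
  the chambers in between, first \<open>c\<close> and then the two halves of the orbit.\<close>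

lemma finite_factorization:
  assumes wt: "weyl_transitive W S C \<delta> G" and c: "c \<in> A" and u: "u \<in> special_fix {c}"
  shows "\<exists>g \<in> special_fix {c}. \<forall>n \<le> N. g (fwd n c) = fwd n c \<and> g (bwd n c) = u (bwd n c)"
proof -
  define x where "x = bwd N c"
  define z where "z = fwd N c"
  have C: "c \<in> C" "x \<in> C" "z \<in> C"
    using c fwd_in bwd_in A_subset by (auto simp: x_def z_def)
  have u': "u \<in> G" "u \<in> special_auts S \<delta> C" "u c = c"
    using u by (auto simp: special_fix_def)
  have btw: "between x c z"
    using between_bwd_fwd[OF c] by (simp add: x_def z_def)
  have ux: "u x \<in> C" "\<delta> (u x) c = \<delta> x c"
    using C u' special_auts_dist[of u x c] by auto
  have xz: "\<delta> x z = \<delta> x c \<otimes> \<delta> c z"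
    using between_dist C btw by blast
  then have "\<delta> (u x) z = \<delta> x z"
    using dist_mult_if_reduced[of "u x" c z] C ux btw by (simp add: between_def)
  then obtain g where g: "g \<in> G" "g \<in> special_auts S \<delta> C" "g x = u x" "g z = z"
    using wt C ux dist_closed[OF C(2,3)] unfolding weyl_transitive_def by (metis Int_iff)
  have "g c = c"
  proof (rule between_unique)
    show "u x \<in> C" "z \<in> C" "g c \<in> C" "c \<in> C"
      using C ux g by auto
    show "between (u x) (g c) z"
      using btw special_auts_dist[OF g(2)] C unfolding between_def by (metis g(3,4))
    show "between (u x) c z"
      using btw ux \<open>\<delta> (u x) z = \<delta> x z\<close> by (simp add: between_def)
    show "\<delta> (u x) (g c) = \<delta> (u x) c"
      using special_auts_dist[OF g(2) C(2,1)] g(3) ux(2) by simp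
  qed
  have id: "\<one>\<^bsub>BijGroup C\<^esub> \<in> special_auts S \<delta> C"
    using in_Bij[OF one_in] by (simp add: special_auts_iff)
  have "g (fwd n c) = fwd n c" if "n \<le> N" for n
  proof -
    have "fwd n c \<in> C" "fwd N c \<in> C"
      using A_subset fwd_in[OF c] by auto
    then show ?thesis
      using agree_on_fwd_ray[OF c g(2) id _ _ that] g(4) \<open>g c = c\<close> C(1) by (simp add: z_def)
  qed
  moreover have "g (bwd n c) = u (bwd n c)" if "n \<le> N" for n
    using agree_on_bwd_ray[OF c g(2) u'(2) _ _ that] g(3) \<open>g c = c\<close> u'(3) by (simp add: x_def)
  ultimately show ?thesis
    using g \<open>g c = c\<close> by (auto simp: special_fix_def)
qed

text \<open>The factors \<open>u\<^sub>+\<close> that work up to stage \<open>N\<close> form a decreasing sequence of non-empty closed subsets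
  of the compact group fixing \<open>c\<close>. An element of their intersection fixes the whole forward orbit and agrees
  with \<open>u\<close> on the whole backward orbit.\<close>

lemma factorization:
  assumes wt: "weyl_transitive W S C \<delta> G" and c: "c \<in> A"
  shows "special_fix {c} = special_fix (range (\<lambda>n. fwd n c)) <#>\<^bsub>Grp\<^esub> special_fix (range (\<lambda>n. bwd n c))"
    (is "_ = ?P <#>\<^bsub>Grp\<^esub> ?M")
proof
  have orbits: "range (\<lambda>n. fwd n c) \<subseteq> C" "range (\<lambda>n. bwd n c) \<subseteq> C" "c \<in> C"
    using c fwd_in bwd_in A_subset by blast+
  show "?P <#>\<^bsub>Grp\<^esub> ?M \<subseteq> special_fix {c}"
  proof
    fix g assume "g \<in> ?P <#>\<^bsub>Grp\<^esub> ?M"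
    then obtain a b where "a \<in> ?P" "b \<in> ?M" "g = a \<otimes>\<^bsub>BijGroup C\<^esub> b"
      by (auto simp: set_mult_def)
    moreover have "c \<in> range (\<lambda>n. fwd n c)" "c \<in> range (\<lambda>n. bwd n c)"
      by (metis funpow_0 rangeI)+
    ultimately show "g \<in> special_fix {c}"
      using special_fix_mult[of a "{c}" b] orbits(3) unfolding special_fix_def by blast
  qed
  show "special_fix {c} \<subseteq> ?P <#>\<^bsub>Grp\<^esub> ?M"
  proof
    fix u assume u: "u \<in> special_fix {c}"
    then have u': "u \<in> G" "u \<in> special_auts S \<delta> C" "u c = c"
      by (auto simp: special_fix_def)
    define K where "K N = {g \<in> special_fix {c}. \<forall>n \<le> N. g (fwd n c) = fwd n c \<and> g (bwd n c) = u (bwd n c)}"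
      for N
    have K_eq: "K N = special_fix {c} \<inter> (\<Inter>n \<le> N. {g \<in> G. g (fwd n c) = fwd n c} \<inter>
        {g \<in> G. g (bwd n c) = u (bwd n c)})" for N
      by (auto simp: K_def special_fix_def)
    have "closedin Top (K N)" for N
      unfolding K_eq using orbits
      by (intro closedin_Int closedin_INT closedin_special_fix closedin_agreement) auto
    then have "closedin (subtopology Top (special_fix {c})) (K N)" for N
      by (intro closedin_subset_topspace) (auto simp: K_def)
    moreover have "compact_space (subtopology Top (special_fix {c}))"
      using compactin_chamber_stab orbits by (intro compact_space_subtopology) auto
    moreover have "K N \<noteq> {}" for N
      using finite_factorization[OF wt c u, of N] by (auto simp: K_def)
    moreover have "decseq K"
      unfolding decseq_def K_def by auto
    ultimately have "(\<Inter>N. K N) \<noteq> {}"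
      by (intro compact_space_imp_nest)
    then obtain g where gK: "\<And>N. g \<in> K N"
      by blast
    then have g: "g \<in> G" "g \<in> special_auts S \<delta> C" "g (fwd n c) = fwd n c"
        "g (bwd n c) = u (bwd n c)" for n
      using gK[of n] by (auto simp: K_def special_fix_def)
    define h where "h = inv\<^bsub>Grp\<^esub> g \<otimes>\<^bsub>BijGroup C\<^esub> u"
    have "g \<in> ?P"
      using g by (auto simp: special_fix_def)
    moreover have "h \<in> ?M"
    proof -
      have "h \<in> special_auts S \<delta> C"
        unfolding h_def using special_inv[of g] g(1,2) u' by (intro special_mult) simp_all
      moreover have "h (bwd n c) = bwd n c" for n
      proof -
        have "bwd n c \<in> C"
          using orbits(2) by blast
        then show ?thesis
          using g(1) u'(1) inv_apply(1)[of g "bwd n c"] unfolding g(4) by (simp add: h_def)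
      qed
      ultimately show ?thesis
        using g(1) u'(1) by (auto simp: special_fix_def h_def)
    qed
    moreover have "u = g \<otimes>\<^bsub>BijGroup C\<^esub> h"
      using g(1) u'(1) unfolding h_def by (intro perm_eqI) auto
    ultimately show "u \<in> ?P <#>\<^bsub>Grp\<^esub> ?M"
      by (auto simp: set_mult_def)
  qed
qed

text \<open>Let \<open>g\<close> be a limit and \<open>h0\<close> an element of the union that agrees with \<open>g\<close> near \<open>c\<close>; it fixes
  \<open>t\<^sup>-\<^sup>n c\<close> for all \<open>n \<ge> N\<close>. Then so does \<open>g\<close>, for the same \<open>N\<close>: an element \<open>h\<close> of the union that agrees
  with \<open>g\<close> at \<open>c\<close> and at \<open>t\<^sup>-\<^sup>n c\<close> agrees with \<open>h0\<close> at \<open>c\<close> and far out in the backward orbit, where both are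
  trivial, hence by rigidity on the whole backward orbit.\<close>

lemma closedin_eventual_fixers:
  assumes c: "c \<in> A"
  shows "closedin Top (\<Union>N. special_fix ((\<lambda>n. bwd n c) ` {N..}))"
  unfolding closedin_Top_iff
proof (intro conjI ballI impI)
  let ?H = "\<Union>N. special_fix ((\<lambda>n. bwd n c) ` {N..})"
  have C: "c \<in> C" "bwd n c \<in> C" for n
    using c bwd_in A_subset by auto
  fix g assume g: "g \<in> G"
    and lim: "\<forall>F. finite F \<longrightarrow> F \<subseteq> C \<longrightarrow> (\<exists>h \<in> ?H. \<forall>x \<in> F. h x = g x)"
  obtain h0 where h0: "h0 \<in> ?H" "\<forall>x \<in> near c. h0 x = g x"
    using lim[rule_format, OF finite_near[OF C(1)] near_subset[OF C(1)]] ..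
  then obtain N where N: "h0 \<in> special_auts S \<delta> C" "\<And>n. n \<ge> N \<Longrightarrow> h0 (bwd n c) = bwd n c"
    by (auto simp: special_fix_def)
  have "g \<in> special_auts S \<delta> C"
    using special_if_agrees_near[of g h0 c] g G_subset_auts N(1) C(1) h0(2) by blast
  moreover have "g (bwd n c) = bwd n c" if n: "n \<ge> N" for n
  proof -
    obtain h where h: "h \<in> ?H" "h c = g c" "h (bwd n c) = g (bwd n c)"
      using lim[rule_format, of "{c, bwd n c}"] C by auto
    then obtain M where M: "h \<in> special_auts S \<delta> C" "\<And>m. m \<ge> M \<Longrightarrow> h (bwd m c) = bwd m c"
      by (auto simp: special_fix_def)
    have "h (bwd n c) = h0 (bwd n c)"
    proof (rule agree_on_bwd_ray[OF c M(1) N(1), where N = "max n (max M N)"])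
      show "h c = h0 c"
        using h h0(2) by (simp add: near_def)
    qed (use M(2) N(2) in auto)
    then show ?thesis
      using h N(2)[OF n] by simp
  qed
  ultimately show "g \<in> ?H"
    using g by (auto simp: special_fix_def)
qed (auto simp: special_fix_def)

lemma tidy_chamber_stab:
  assumes wt: "weyl_transitive W S C \<delta> G" and c: "c \<in> A"
  shows "tidy_for Grp Top t (special_fix {c})"
proof -
  have cC: "c \<in> C" and bwd_C: "bwd n c \<in> C" for n
    using c bwd_in A_subset by auto
  have conj: "(\<lambda>x \<in> carrier Grp. t \<otimes>\<^bsub>Grp\<^esub> x \<otimes>\<^bsub>Grp\<^esub> inv\<^bsub>Grp\<^esub> t) = conj_by t"
    by (simp add: conj_by_def)
  have plus: "tidy_plus (conj_by t) (special_fix {c}) = special_fix (range (\<lambda>n. fwd n c))"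
    unfolding tidy_plus_def using conj_by_funpow_special_fix[OF t_in, of "{c}"] cC
    by (auto simp: special_fix_def)
  have minus: "tidy_minus Grp (conj_by t) (special_fix {c}) = special_fix (range (\<lambda>n. bwd n c))"
    unfolding tidy_minus_def using inv_conj_by_funpow_special_fix[OF t_in, of "{c}"] cC
    by (auto simp: special_fix_def)
  have "(inv_into G (conj_by t) ^^ N) ` special_fix (range (\<lambda>n. bwd n c))
      = special_fix ((\<lambda>n. bwd n c) ` {N..})" for N
  proof -
    have "bwd N ` range (\<lambda>n. bwd n c) = (\<lambda>n. bwd n c) ` {N..}"
    proof -
      have "bwd N ` range (\<lambda>n. bwd n c) = (\<lambda>n. bwd n c) ` range (\<lambda>n. N + n)"
        by (simp add: image_image funpow_add)
      also have "range (\<lambda>n. N + n) = {N..}"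
        by (auto simp: image_iff le_iff_add)
      finally show ?thesis .
    qed
    then show ?thesis
      using inv_conj_by_funpow_special_fix[OF t_in, of "range (\<lambda>n. bwd n c)" N] bwd_C by auto
  qed
  then show ?thesis
    unfolding tidy_for_def tidy_for_aut_def conj plus minus
    using subgroup_special_fix[of "{c}"] compactin_chamber_stab[OF cC] openin_chamber_stab[OF cC]
      factorization[OF wt c] closedin_eventual_fixers[OF c] cC
    by simp
qed

end

theorem corollary3p14:
  fixes W :: "('w, 'm) monoid_scheme" and S :: "'w set"
    and C :: "'c set" and \<delta> :: "'c \<Rightarrow> 'c \<Rightarrow> 'w"
    and G :: "('c \<Rightarrow> 'c) set" and A :: "'c set" and c :: 'c and t :: "'c \<Rightarrow> 'c"
  assumes "coxeter_system W S" and "finite S"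
    and "building W S C \<delta>" and "thick W S C \<delta>" and "locally_finite W S C \<delta>"
    and "subgroup G (aut_group W S C \<delta>)"
    and "closedin (perm_topology (aut_group W S C \<delta>) C) G"
    and "weyl_transitive W S C \<delta> G"
    and "apartment W S C \<delta> A" and "c \<in> A"
    and "t \<in> G" and "t ` A = A"
    and "apartment_translation W S \<delta> A (restrict t A)"
  shows "tidy_for ((aut_group W S C \<delta>)\<lparr>carrier := G\<rparr>)
           (subtopology (perm_topology (aut_group W S C \<delta>) C) G)
           t ({g \<in> G. g c = c} \<inter> special_auts S \<delta> C)"
proof -
  interpret building_group W S C \<delta> G
    by (intro building_group.intro building_group_axioms.intro assms)
  have AC: "A \<subseteq> C"
    using apartment_subset assms by blast
  have "inj_on t A"
    using AC assms apply_eq_iff[of t] by (auto intro!: inj_onI simp: subset_iff)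
  then interpret straight_element W S C \<delta> G A t
    using AC assms translation_orbit_between by unfold_locales auto
  have "{g \<in> G. g c = c} \<inter> special_auts S \<delta> C = special_fix {c}"
    by (auto simp: special_fix_def)
  then show ?thesis
    unfolding aut_group_update subtopology_aut using tidy_chamber_stab assms by simp
qed

end
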